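(* Let $0<\beta\le 1$. The fractional linear multistep method $$\sum_{k=0}^{\infty} g_k^{(\beta)}\left[\left(1+\frac{\beta}{2}\right)y_{n-k}-\frac{\beta}{2}\,y_{n-k-1}\right]=h^\beta f_n,\qquad n=1,2,\dots,$$ for the problem $D_t^\beta y(t)=f(t,y(t))$, $t\ge 0$, $y(0)=0$, is consistent with order $2$. That is, for every sufficiently smooth $y$ (extended by zero to $t<0$) and every fixed $t>0$, $$\frac{1}{h^\beta}\sum_{k=0}^{\infty} g_k^{(\beta)}\left[\left(1+\frac{\beta}{2}\right)y(t-kh)-\frac{\beta}{2}\,y(t-(k+1)h)\right]=D_t^\beta y(t)+O(h^2)\qquad\text{as } h\to 0^+ .$$
   Context: The Grünwald weights are $g_0^{(\beta)}=1$, $g_k^{(\beta)}=\left(1-\frac{\beta+1}{k}\right)g_{k-1}^{(\beta)}$ for $k\ge 1$; equivalently, $(1-z)^\beta=\sum_{k\ge 0}g_k^{(\beta)}z^k$. $D_t^\beta$ is the left Riemann–Liouville derivative based at $0$: for $0<\beta<1$, $D_t^\beta y(t)=\frac{1}{\Gamma(1-\beta)}\frac{d}{dt}\int_0^t\frac{y(\tau)}{(t-\tau)^{\beta}}\,d\tau$, and for $\beta=1$, $D_t^1y=y'$. In the method, $h>0$ is the step size, $t_n=nh$, $y_n\approx y(t_n)$, $f_n=f(t_n,y_n)$, and $y_j=0$ for $j<0$. Functions $y$ are extended by zero to $t<0$, so all the sums are finite. "Sufficiently smooth" means: there is an integer $m\ge 1$ such that the assertion holds for every function $y\in C^m(\mathbb{R})$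 with $y(t)=0$ for all $t\le 0$. *)

theory Defs
  imports "HOL-Analysis.Analysis" "HOL-Library.Landau_Symbols"
begin

fun grunwald :: "real \<Rightarrow> nat \<Rightarrow> real" where
  "grunwald \<beta> 0 = 1"
| "grunwald \<beta> (Suc k) = (1 - (\<beta> + 1) / real (Suc k)) * grunwald \<beta> k"

(* The left Riemann-Liouville derivative of order \<beta> based at 0, as a relation so that
   existence of the derivative is part of what is asserted; only 0 < \<beta> \<le> 1 is intended.
   The value of the integrand at \<tau> = s (division by 0) does not affect the integral. *)
definition has_RL_derivative :: "real \<Rightarrow> (real \<Rightarrow> real) \<Rightarrow> real \<Rightarrow> real \<Rightarrow> bool" where
  "has_RL_derivative \<beta> y D t \<longleftrightarrow>
     (if \<beta> = 1 then (y has_real_derivative D) (at t)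
      else (\<forall>s>0. (\<lambda>\<tau>. y \<tau> / (s - \<tau>) powr \<beta>) integrable_on {0..s}) \<and>
           (\<exists>I'. ((\<lambda>s. integral {0..s} (\<lambda>\<tau>. y \<tau> / (s - \<tau>) powr \<beta>)) has_real_derivative I') (at t) \<and>
                 D = 1 / Gamma (1 - \<beta>) * I'))"

definition C_m :: "nat \<Rightarrow> (real \<Rightarrow> real) \<Rightarrow> bool" where
  "C_m m y \<longleftrightarrow>
     (\<forall>j<m. \<forall>x. ((deriv ^^ j) y) field_differentiable (at x)) \<and>
     continuous_on UNIV ((deriv ^^ m) y)"

(* A method \<open>A y n = h\<^sup>\<beta> f\<^sub>n\<close> for \<open>D\<^sup>\<beta> y = f(t, y)\<close> is given by its left-hand side A, acting on
   integer-indexed sequences. Its consistency at t is tested on the samples y(t + j h), so that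
   index 0 stands for the point t and index -k for t - k h. *)
definition consistent_with_order ::
  "real \<Rightarrow> ((int \<Rightarrow> real) \<Rightarrow> int \<Rightarrow> real) \<Rightarrow> nat \<Rightarrow> bool" where
  "consistent_with_order \<beta> A p \<longleftrightarrow>
     (\<exists>m\<ge>1. \<forall>y. C_m m y \<and> (\<forall>t\<le>0. y t = 0) \<longrightarrow>
        (\<forall>t>0. \<exists>D. has_RL_derivative \<beta> y D t \<and>
           (\<lambda>h. 1 / h powr \<beta> * A (\<lambda>j. y (t + of_int j * h)) 0 - D) \<in> O[at_right 0](\<lambda>h. h ^ p)))"

lemma consistent_with_order_explicit:
  "consistent_with_order \<beta>
     (\<lambda>u n. \<Sum>k. grunwald \<beta> k * (a * u (n - int k) - b * u (n - int k - 1))) p \<longleftrightarrow>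
   (\<exists>m\<ge>1. \<forall>y. C_m m y \<and> (\<forall>t\<le>0. y t = 0) \<longrightarrow>
      (\<forall>t>0. \<exists>D. has_RL_derivative \<beta> y D t \<and>
         (\<lambda>h. 1 / h powr \<beta> *
               (\<Sum>k. grunwald \<beta> k * (a * y (t - real k * h) - b * y (t - real (k + 1) * h))) - D)
           \<in> O[at_right 0](\<lambda>h. h ^ p)))"
proof -
  have "t + of_int (0 - int k) * h = t - real k * h"
    and "t + of_int (0 - int k - 1) * h = t - real (k + 1) * h" for t h :: real and k
    by (simp_all add: algebra_simps)
  then show ?thesis
    unfolding consistent_with_order_def by presburger
qed

end

theory Submission
  imports Defs "HOL-Real_Asymp.Real_Asymp"
begin

text \<open>
  Take \<open>m = 4\<close> and write \<open>v\<close> for the fourth derivative of \<open>y\<close>. Since \<open>y\<close> and its first three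
  derivatives vanish at \<open>0\<close>, \<open>y(x) = 1/6 \<integral>\<^sub>0\<^sup>t (x - s)\<^sub>+\<^sup>3 v(s) ds\<close> for \<open>x \<le> t\<close>, and
  \<open>D\<^sup>\<beta> y(t) = 1/\<Gamma>(4 - \<beta>) \<integral>\<^sub>0\<^sup>t (t - s)\<^bsup>3 - \<beta>\<^esup> v(s) ds\<close>. By linearity and scaling (\<open>X = (t - s)/h\<close>) it
  suffices to apply the method with step \<open>1\<close> to the truncated cube: up to an error \<open>O(1 + X\<^bsup>1 - \<beta>\<^esup>)\<close>,
  uniform in real \<open>X \<ge> 0\<close>, the result has to be \<open>6/\<Gamma>(4 - \<beta>) X\<^bsup>3 - \<beta>\<^esup>\<close>; the prefactor \<open>h\<^bsup>3 - \<beta>\<^esup>\<close> turns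
  this error into \<open>O(h\<^sup>2)\<close>.

  The sums \<open>\<Sum>\<^sub>k\<^sub>\<le>\<^sub>n g\<^sub>k (n - k)\<^sup>j\<close>, \<open>j \<le> 3\<close>, are \<open>\<Gamma>(n + 1 - \<beta>)/\<Gamma>(n)\<close> times explicit polynomials in
  \<open>n\<close> (divided by \<open>n\<close> if \<open>j = 0\<close>), and the expansion
  \<open>\<Gamma>(n + a)/\<Gamma>(n) = n\<^sup>a (1 + a(a - 1)/(2n) + O(n\<^sup>-\<^sup>2))\<close> yields
  \<open>\<Sum>\<^sub>k g\<^sub>k (X - k)\<^sub>+\<^sup>3 = 6/\<Gamma>(4 - \<beta>) (X\<^bsup>3 - \<beta>\<^esup> - \<beta>(3 - \<beta>)/2 X\<^bsup>2 - \<beta>\<^esup>) + O(1 + X\<^bsup>1 - \<beta>\<^esup>)\<close>.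
  The weights \<open>1 + \<beta>/2\<close> and \<open>-\<beta>/2\<close> are exactly those that cancel the second term.
\<close>

section \<open>Moments of the Grunwald weights\<close>

text \<open>For \<open>j = 0\<close> the summand \<open>k = n\<close> is \<open>grunwald \<beta> n\<close>, because \<open>0 ^ 0 = 1\<close>.\<close>

definition gmoment :: "real \<Rightarrow> nat \<Rightarrow> nat \<Rightarrow> real" where
  "gmoment \<beta> j n = (\<Sum>k\<le>n. grunwald \<beta> k * (real n - real k) ^ j)"

text \<open>Compare coefficients of z^n in the derivative of (1 - z)^\<beta>, which is -\<beta> (1 -
  z)^(\<beta> - 1): dividing (1 - z)^\<beta> by 1 - z turns coefficients into partial sums. The
  formal proof is an induction along the recurrence.\<close>

lemma Suc_times_grunwald_Suc:
  "real (Suc n) * grunwald \<beta> (Suc n) = - \<beta> * gmoment \<beta> 0 n"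
proof (induction n)
  case (Suc n)
  have "real (Suc (Suc n)) * grunwald \<beta> (Suc (Suc n)) = (real (Suc n) - \<beta>) * grunwald \<beta> (Suc n)"
  proof -
    have "real (Suc (Suc n)) * (1 - (\<beta> + 1) / real (Suc (Suc n))) = real (Suc n) - \<beta>"
      by (simp add: field_simps)
    thus ?thesis by (subst grunwald.simps(2)) (simp only: mult.assoc[symmetric])
  qed
  also have "\<dots> = - \<beta> * gmoment \<beta> 0 n - \<beta> * grunwald \<beta> (Suc n)"
    using Suc by (simp add: algebra_simps del: grunwald.simps)
  finally show ?case
    by (simp add: gmoment_def algebra_simps del: grunwald.simps)
qed (simp add: gmoment_def)

text \<open>The new summand is eliminated by the previous identity. The resulting ratio of
  consecutive values is what leads to Gamma quotients.\<close>

lemma gmoment_0_Suc: "real (Suc n) * gmoment \<beta> 0 (Suc n) = (real (Suc n) - \<beta>) * gmoment \<beta> 0 n"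
  using Suc_times_grunwald_Suc[of n \<beta>] by (simp add: gmoment_def algebra_simps del: grunwald.simps)

text \<open>The summand \<open>k = Suc n\<close> contains \<open>0 ^ j\<close>, which is zero
  because \<open>j > 0\<close>. Expanding the remaining powers yields recurrences involving only
  moments of order at most \<open>j\<close>.\<close>

lemma gmoment_Suc:
  assumes "j > 0"
  shows "gmoment \<beta> j (Suc n) = (\<Sum>k\<le>n. grunwald \<beta> k * (real n - real k + 1) ^ j)"
  using assms by (simp add: gmoment_def add_diff_eq add_ac del: grunwald.simps)

text \<open>Binomial expansion in \<open>\<theta>\<close>. The value 1 gives the recurrence of the
  third moment; later \<open>\<theta>\<close> is the fractional part of a real argument.\<close>

lemma sum_grunwald_cube:
  "(\<Sum>k\<le>n. grunwald \<beta> k * (real n - real k + \<theta>) ^ 3) =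
     gmoment \<beta> 3 n + 3 * \<theta> * gmoment \<beta> 2 n + 3 * \<theta>\<^sup>2 * gmoment \<beta> 1 n + \<theta> ^ 3 * gmoment \<beta> 0 n"
  unfolding gmoment_def sum_distrib_left sum.distrib[symmetric]
  by (intro sum.cong) (auto simp: algebra_simps power2_eq_square power3_eq_cube)

lemma gmoment_1_Suc: "gmoment \<beta> 1 (Suc n) = gmoment \<beta> 1 n + gmoment \<beta> 0 n"
  by (subst gmoment_Suc) (simp_all add: gmoment_def distrib_left sum.distrib)

lemma gmoment_2_Suc: "gmoment \<beta> 2 (Suc n) = gmoment \<beta> 2 n + 2 * gmoment \<beta> 1 n + gmoment \<beta> 0 n"
proof -
  have "gmoment \<beta> 2 (Suc n) = (\<Sum>k\<le>n. grunwald \<beta> k * (real n - real k)\<^sup>2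
          + 2 * (grunwald \<beta> k * (real n - real k)) + grunwald \<beta> k)"
    by (subst gmoment_Suc) (auto intro!: sum.cong simp: algebra_simps power2_eq_square)
  thus ?thesis by (simp add: gmoment_def sum.distrib sum_distrib_left)
qed

lemma gmoment_3_Suc:
  "gmoment \<beta> 3 (Suc n) = gmoment \<beta> 3 n + 3 * gmoment \<beta> 2 n + 3 * gmoment \<beta> 1 n + gmoment \<beta> 0 n"
  using sum_grunwald_cube[of \<beta> n 1] by (subst gmoment_Suc) simp_all

text \<open>A discrete analogue of \<open>n powr a\<close>, with consecutive ratio
  \<open>1 + a / n\<close>. For \<open>\<beta> = 1\<close> it occurs with \<open>a = 0\<close> and
  equals 1 at every \<open>n > 0\<close>, so the classical case obeys the same formulas.\<close>

definition Gamma_quot :: "real \<Rightarrow> nat \<Rightarrow> real" where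
  "Gamma_quot a n = Gamma (real n + a) / Gamma (real n)"

lemma Gamma_quot_Suc:
  assumes "a \<ge> 0" "n > 0"
  shows "Gamma_quot a (Suc n) = Gamma_quot a n * (real n + a) / real n"
proof -
  have "Gamma (real n + a + 1) = (real n + a) * Gamma (real n + a)"
    "Gamma (real n + 1) = real n * Gamma (real n)"
    using assms nonpos_Ints_nonpos[of "real n + a"] nonpos_Ints_nonpos[of "real n"]
    by (force intro!: Gamma_plus1)+
  thus ?thesis unfolding Gamma_quot_def by (simp add: add_ac mult_ac)
qed

text \<open>One induction serves all four formulas, because the recurrences involve the lower
  moments. It starts at \<open>n = 1\<close>, where the moments are \<open>1 - \<beta>\<close>, 1,
  1, 1. The divisor \<open>Gamma (4 - \<beta>)\<close> exhibits
  \<open>6 / Gamma (4 - \<beta>)\<close>, the constant in the fractional derivative of the cube, as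
  leading coefficient of the third moment.\<close>

lemma gmoment_eq:
  fixes \<beta> :: real
  assumes "\<beta> \<le> 1" "n > 0"
  defines "R \<equiv> \<lambda>n. Gamma_quot (1 - \<beta>) n / Gamma (4 - \<beta>)"
  shows "gmoment \<beta> 0 n = (3 - \<beta>) * (2 - \<beta>) * (1 - \<beta>) * R n / n \<and>
         gmoment \<beta> 1 n = (3 - \<beta>) * (2 - \<beta>) * R n \<and>
         gmoment \<beta> 2 n = 2 * (3 - \<beta>) * R n * (n - \<beta> / 2) \<and>
         gmoment \<beta> 3 n = 6 * R n * (n\<^sup>2 - \<beta> * n + \<beta> * (1 + \<beta>) / 6)"
  using assms(2)
proof (induction n rule: nat_induct_non_zero)
  case 1
  have "3 - \<beta> \<notin> \<int>\<^sub>\<le>\<^sub>0" "2 - \<beta> \<notin> \<int>\<^sub>\<le>\<^sub>0"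
    using assms(1) nonpos_Ints_nonpos by fastforce+
  hence "Gamma (4 - \<beta>) = (3 - \<beta>) * Gamma (3 - \<beta>)" "Gamma (3 - \<beta>) = (2 - \<beta>) * Gamma (2 - \<beta>)"
    using Gamma_plus1[of "3 - \<beta>"] Gamma_plus1[of "2 - \<beta>"] by auto
  moreover have "Gamma (2 - \<beta>) \<noteq> 0"
    using assms(1) Gamma_real_pos[of "2-\<beta>"] by linarith
  ultimately have "(3 - \<beta>) * (2 - \<beta>) * R 1 = 1"
    using assms(1) by (simp add: R_def Gamma_quot_def)
  hence R1: "R 1 = 1 / ((3 - \<beta>) * (2 - \<beta>))"
    using assms(1) nonzero_eq_divide_eq[of "(3 - \<beta>) * (2 - \<beta>)" "R 1" 1] by (simp add: mult_ac)
  show ?case unfolding R1 using assms(1) by (auto simp: gmoment_def divide_simps) algebra+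
next
  case (Suc n)
  define x where "x = real n"
  \<comment> \<open>In terms of \<open>x\<close>, \<open>\<beta>\<close> and \<open>g0\<close> both
    \<open>R n\<close> and \<open>R (Suc n)\<close> are polynomials, so the induction step reduces
    to polynomial identities.\<close>
  define g0 where "g0 = R n / x"
  have x: "x > 0" using Suc by (simp add: x_def)
  have Rn: "R n = x * g0" using x by (simp add: g0_def)
  have "R (Suc n) = R n * (x + (1 - \<beta>)) / x"
    using Gamma_quot_Suc[of "1-\<beta>" n] assms(1) Suc(1) by (simp add: R_def x_def)
  hence RS: "R (Suc n) = (x + 1 - \<beta>) * g0" using x by (simp add: Rn add_diff_eq)
  have g: "gmoment \<beta> 0 n = (3 - \<beta>) * (2 - \<beta>) * (1 - \<beta>) * g0"
    "gmoment \<beta> 1 n = (3 - \<beta>) * (2 - \<beta>) * (x * g0)"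
    "gmoment \<beta> 2 n = 2 * (3 - \<beta>) * (x * g0) * (x - \<beta> / 2)"
    "gmoment \<beta> 3 n = 6 * (x * g0) * (x\<^sup>2 - \<beta> * x + \<beta> * (1 + \<beta>) / 6)"
    using Suc(2) x by (auto simp: Rn x_def[symmetric])
  have S: "real (Suc n) = x + 1" by (simp add: x_def)
  have "(x + 1) * gmoment \<beta> 0 (Suc n) = (x + 1 - \<beta>) * gmoment \<beta> 0 n"
    using gmoment_0_Suc[of n \<beta>] unfolding S .
  hence "gmoment \<beta> 0 (Suc n) = (3 - \<beta>) * (2 - \<beta>) * (1 - \<beta>) * R (Suc n) / real (Suc n)"
    unfolding g RS S using x by (simp add: field_simps)
  moreover have "gmoment \<beta> 1 (Suc n) = (3 - \<beta>) * (2 - \<beta>) * R (Suc n)"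
    unfolding gmoment_1_Suc g RS S by algebra
  moreover have "gmoment \<beta> 2 (Suc n) = 2 * (3 - \<beta>) * R (Suc n) * (real (Suc n) - \<beta> / 2)"
    unfolding gmoment_2_Suc g RS S by (simp add: field_simps power2_eq_square)
  moreover have "gmoment \<beta> 3 (Suc n) =
      6 * R (Suc n) * ((real (Suc n))\<^sup>2 - \<beta> * real (Suc n) + \<beta> * (1 + \<beta>) / 6)"
    unfolding gmoment_3_Suc g RS S by (simp add: field_simps power2_eq_square)
  ultimately show ?case by simp
qed

section \<open>Two-term expansion of Gamma quotients\<close>

text \<open>Maclaurin's formula with Lagrange remainder, applied for \<open>n > 0\<close> and
  \<open>u > 0\<close>. The exponent \<open>p - n\<close> may have either sign; its absolute value
  gives a majorant that is largest at the endpoint \<open>b\<close>.\<close>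

lemma powr_Taylor_bound:
  fixes p b :: real
  shows "\<exists>C\<ge>0. \<forall>u. 0 \<le> u \<longrightarrow> u \<le> b \<longrightarrow>
           \<bar>(1 + u) powr p - (\<Sum>m<n. (p gchoose m) * u ^ m)\<bar> \<le> C * u ^ n"
proof (cases "n = 0")
  case True
  have "(1 + u) powr p \<le> (1 + b) powr \<bar>p\<bar>" if "0 \<le> u" "u \<le> b" for u
    using that powr_mono[of p "\<bar>p\<bar>" "1 + u"] powr_mono2[of "\<bar>p\<bar>" "1+u" "1+b"] abs_ge_self[of p]
    by linarith
  thus ?thesis using True by (intro exI[of _ "(1 + b) powr \<bar>p\<bar>"]) auto
next
  case False
  define C where "C = \<bar>p gchoose n\<bar> * (1 + b) powr \<bar>p - n\<bar>"
  show ?thesis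
  proof (intro exI[of _ C] conjI allI impI)
    fix u :: real assume u: "0 \<le> u" "u \<le> b"
    show "\<bar>(1 + u) powr p - (\<Sum>m<n. (p gchoose m) * u ^ m)\<bar> \<le> C * u ^ n"
    proof (cases "u = 0")
      case True
      have "(\<Sum>m<n. (p gchoose m) * 0 ^ m) = (\<Sum>m\<in>{0}. (p gchoose m) * 0 ^ m)"
        using False by (intro sum.mono_neutral_right) auto
      thus ?thesis using True False by (simp add: zero_power)
    next
      case u0: False
      let ?diff = "\<lambda>m t. (p gchoose m) * fact m * (1 + t) powr (p - real m)"
      have "\<exists>t>0. t < u \<and> (1 + u) powr p =
              (\<Sum>m<n. ?diff m 0 / fact m * u ^ m) + ?diff n t / fact n * u ^ n"
      proof (rule Maclaurin)
        show "\<forall>m t. m < n \<and> 0 \<le> t \<and> t \<le> u \<longrightarrow> (?diff m has_real_derivative ?diff (Suc m) t) (at t)"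
        proof (intro allI impI)
          fix m t assume t: "m < n \<and> 0 \<le> t \<and> t \<le> u"
          have "(p gchoose Suc m) * fact (Suc m) = (p gchoose m) * fact m * (p - real m)"
            unfolding gbinomial_mult_fact' by simp
          thus "(?diff m has_real_derivative ?diff (Suc m) t) (at t)"
            using t by (auto intro!: derivative_eq_intros simp del: fact_Suc simp: mult.assoc diff_diff_eq add_ac)
        qed
      qed (use u u0 False in auto)
      then obtain t where t: "0 < t" "t < u" "(1 + u) powr p =
              (\<Sum>m<n. (p gchoose m) * u ^ m) + (p gchoose n) * (1 + t) powr (p - real n) * u ^ n"
        by auto
      have "(1 + t) powr (p - real n) \<le> (1 + t) powr \<bar>p - real n\<bar>"
        using t by (intro powr_mono) auto
      also have "\<dots> \<le> (1 + b) powr \<bar>p - real n\<bar>"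
        using t u by (intro powr_mono2) auto
      finally show ?thesis
        using t u by (auto simp: C_def abs_mult intro!: mult_mono)
    qed
  qed (simp add: C_def)
qed

text \<open>A null sequence is minus the sum of its later increments, and the tails of the series of
  1/n^(p+1) are of order 1/n^p. In place of series, \<open>s n + K / n ^ p\<close> and
  \<open>- s n + K / n ^ p\<close> are shown to be eventually decreasing with limit 0, hence
  nonnegative.\<close>

lemma telescope_bigo:
  fixes s :: "nat \<Rightarrow> real"
  assumes "s \<longlonglongrightarrow> 0" and "(\<lambda>n. s (Suc n) - s n) \<in> O(\<lambda>n. 1 / real n ^ (Suc p))" and "p > 0"
  shows "s \<in> O(\<lambda>n. 1 / real n ^ p)"
proof -
  \<comment> \<open>A telescoping majorant, from
    \<open>(n + 1) ^ p - n ^ p \<ge> n ^ (p - 1)\<close> and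
    \<open>(n + 1) ^ p \<le> (2 * n) ^ p\<close>; the latter is the source of
    \<open>2 ^ p\<close>.\<close>
  have *: "1 / real n ^ Suc p \<le> 2 ^ p * (1 / real n ^ p - 1 / real (Suc n) ^ p)" if "n > 0" for n
  proof -
    define x where "x = real n"
    have x: "x > 0" "x \<ge> 1" using that by (auto simp: x_def)
    obtain q where p: "p = Suc q" using assms(3) by (cases p) auto
    have "x ^ q \<le> (x + 1) ^ q" using x by (intro power_mono) auto
    hence 1: "x ^ p \<le> ((x + 1) ^ p - x ^ p) * x"
      using x mult_left_mono[of "x ^ q" "(x+1) ^ q" "x*(x+1)"]
      unfolding p by (simp add: algebra_simps)
    have "(x + 1) ^ p \<le> (2 * x) ^ p" using x by (intro power_mono) auto
    hence 2: "(x + 1) ^ p \<le> 2 ^ p * x ^ p" by (simp add: power_mult_distrib)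
    have "1 / (x ^ p * x) \<le> 2 ^ p / ((x + 1) ^ p * x)"
      using 2 x by (simp add: divide_simps mult_ac)
    also have "\<dots> = 2 ^ p * (x ^ p / ((x + 1) ^ p * x ^ p * x))"
      using x by simp
    also have "\<dots> \<le> 2 ^ p * (((x + 1) ^ p - x ^ p) * x / ((x + 1) ^ p * x ^ p * x))"
      using 1 x by (intro mult_left_mono divide_right_mono) auto
    also have "\<dots> = 2 ^ p * (1 / x ^ p - 1 / (x + 1) ^ p)"
      using x by (simp add: diff_frac_eq)
    finally show ?thesis by (simp add: x_def algebra_simps)
  qed
  from assms(2) obtain C where C: "C > 0"
    "eventually (\<lambda>n. norm (s (Suc n) - s n) \<le> C * norm (1 / real n ^ Suc p)) sequentially"
    by (elim landau_o.bigE)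
  define K where "K = C * 2 ^ p"
  from C(2) obtain N where N: "\<And>n. n \<ge> N \<Longrightarrow> \<bar>s (Suc n) - s n\<bar> \<le> C * (1 / real n ^ Suc p)"
    by (auto simp: eventually_at_top_linorder)
  have step: "\<bar>s (Suc n) - s n\<bar> \<le> K / real n ^ p - K / real (Suc n) ^ p" if "n \<ge> N" "n > 0" for n
    using order.trans[OF N[OF that(1)] mult_left_mono[OF *[OF that(2)], of C]] C(1)
    by (simp add: K_def right_diff_distrib)
  have lim: "(\<lambda>m. K / real m ^ p) \<longlonglongrightarrow> 0"
    using assms(3) by real_asymp
  have bound: "0 \<le> \<sigma> * s n + K / real n ^ p" if "n \<ge> N" "n > 0" "\<bar>\<sigma>\<bar> = 1" for n \<sigma>
  proof -
    have dec: "decseq (\<lambda>m. \<sigma> * s (m + n) + K / real (m + n) ^ p)"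
    proof (rule decseq_SucI)
      fix m
      have "\<sigma> * (s (Suc (m + n)) - s (m + n)) \<le> \<bar>s (Suc (m + n)) - s (m + n)\<bar>"
        using that(3) by (auto simp: abs_if split: if_splits)
      also have "\<dots> \<le> K / real (m + n) ^ p - K / real (Suc (m + n)) ^ p"
        using that by (intro step) auto
      finally show "\<sigma> * s (Suc m + n) + K / real (Suc m + n) ^ p \<le> \<sigma> * s (m + n) + K / real (m + n) ^ p"
        by (simp add: right_diff_distrib)
    qed
    have "(\<lambda>m. \<sigma> * s m + K / real m ^ p) \<longlonglongrightarrow> \<sigma> * 0 + 0"
      by (intro tendsto_intros assms lim)
    hence "(\<lambda>m. \<sigma> * s (m + n) + K / real (m + n) ^ p) \<longlonglongrightarrow> 0"
      using LIMSEQ_ignore_initial_segment[of "\<lambda>m. \<sigma> * s m + K / real m ^ p" _ n] by simp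
    from decseq_ge[OF dec this, of 0] show ?thesis by simp
  qed
  have "eventually (\<lambda>n. norm (s n) \<le> K * norm (1 / real n ^ p)) sequentially"
    using eventually_ge_at_top[of N] eventually_gt_at_top[of 0]
  proof eventually_elim
    case (elim n)
    with bound[of n 1] bound[of n "-1"] show ?case by simp
  qed
  thus ?thesis by (rule landau_o.bigI[rotated]) (use C in \<open>simp add: K_def\<close>)
qed

text \<open>The Gauss limit formula for Gamma, taken at \<open>1 + a\<close>: as
  \<open>a = 0\<close> is allowed, the shift avoids the pole at 0, and the factor
  \<open>1 + a / n\<close> undoes it.\<close>

lemma Gamma_quot_lim:
  assumes "a \<ge> 0"
  shows "(\<lambda>n. Gamma_quot a n / real n powr a) \<longlonglongrightarrow> 1"
proof -
  have "Gamma_series' (1 + a) \<longlonglongrightarrow> Gamma (1 + a)"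
    by (rule Gamma_series'_LIMSEQ)
  moreover have G: "Gamma (1 + a) > 0" using assms by (intro Gamma_real_pos) auto
  ultimately have "(\<lambda>n. Gamma (1 + a) / Gamma_series' (1 + a) n / (1 + a / real n))
      \<longlonglongrightarrow> Gamma (1 + a) / Gamma (1 + a) / (1 + 0)"
    by (intro tendsto_intros) (auto intro: real_tendsto_divide_at_top filterlim_real_sequentially)
  hence lim: "(\<lambda>n. Gamma (1 + a) / Gamma_series' (1 + a) n / (1 + a / real n)) \<longlonglongrightarrow> 1"
    using G by simp
  show ?thesis
  proof (rule Lim_transform_eventually[OF lim])
    show "\<forall>\<^sub>F n in sequentially. Gamma (1 + a) / Gamma_series' (1 + a) n / (1 + a / real n) =
              Gamma_quot a n / real n powr a"
      using eventually_gt_at_top[of 0]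
    proof eventually_elim
      case (elim n)
      have "Gamma (1 + a + real n) = (real n + a) * Gamma (real n + a)"
        using Gamma_plus1[of "real n + a"] elim assms nonpos_Ints_nonpos[of "real n + a"]
        by (fastforce simp: add_ac)
      moreover have "Gamma (1 + a + real n) = Gamma (1 + a) * pochhammer (1 + a) n"
        proof -
        have "1 + a \<notin> \<int>\<^sub>\<le>\<^sub>0" using nonpos_Ints_nonpos[of "1 + a"] assms by linarith
        from pochhammer_Gamma[OF this, of n] show ?thesis using G by simp
      qed
      moreover have "Gamma (real n) = fact (n - 1)"
        using Gamma_fact[of "n - 1", where 'a = real] elim by (simp add: of_nat_diff)
      moreover have "exp ((1 + a) * ln (real n)) = real n * real n powr a"
        using elim by (simp add: powr_def exp_add[symmetric] distrib_right)
          (simp add: exp_add)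
      moreover have "pochhammer (1 + a) n > 0" using assms by (intro pochhammer_pos) auto
      moreover have "real n powr a > 0" using elim by simp
      ultimately show ?case using elim assms
        by (simp add: Gamma_quot_def Gamma_series'_def divide_simps)
    qed
  qed
qed

text \<open>The normalised quotient \<open>w\<close> has consecutive ratio
  \<open>(1 + a / n) * (1 + 1 / n) powr (-a)\<close>, which is 1 - c/n^2 + O(n^-3). Its increments
  are therefore close to -c/n^2, and summing them back from the limit 1 produces the term
  c/n.\<close>

lemma Gamma_quot_asymp:
  assumes "a \<ge> 0"
  shows "(\<lambda>n. Gamma_quot a n / real n powr a - 1 - a * (a - 1) / 2 / real n) \<in> O(\<lambda>n. 1 / real n ^ 2)"
proof -
  define w where "w = (\<lambda>n. Gamma_quot a n / real n powr a)"
  define c where "c = a * (a - 1) / 2"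
  define \<delta> where "\<delta> = (\<lambda>n. (1 + a / real n) * (1 + 1 / real n) powr (-a) - 1 + c / real n ^ 2)"
  obtain C where C: "C \<ge> 0" "\<And>u. 0 \<le> u \<Longrightarrow> u \<le> 1 \<Longrightarrow> \<bar>(1 + u) powr (-a) - (\<Sum>m<3. ((-a) gchoose m) * u ^ m)\<bar> \<le> C * u ^ 3"
    using powr_Taylor_bound[where p = "-a" and n = 3 and b = 1] by blast
  have "eventually (\<lambda>n. norm ((1 + 1 / real n) powr (-a) - 1 + a / real n - a * (a + 1) / 2 / real n ^ 2) \<le>
            C * norm (1 / real n ^ 3)) sequentially"
    using eventually_gt_at_top[of 0]
  proof eventually_elim
    case (elim n)
    have "(\<Sum>m<3. ((-a) gchoose m) * (1 / real n) ^ m) = 1 - a / real n + a * (a + 1) / 2 / real n ^ 2"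
      by (simp add: eval_nat_numeral gbinomial_Suc field_simps)
    thus ?case using C(2)[of "1 / real n"] elim by (simp add: power_divide diff_diff_eq2 diff_add_eq)
  qed
  hence 1: "(\<lambda>n::nat. (1 + 1 / real n) powr (-a) - 1 + a / real n - a * (a + 1) / 2 / real n ^ 2) \<in> O(\<lambda>n. 1 / real n ^ 3)"
    by (rule bigoI)
  \<comment> \<open>The product of \<open>1 + a / n\<close> with the quadratic Taylor polynomial is
    1 - c/n^2 plus exactly the cubic term added here.\<close>
  have "(\<lambda>n. (1 + a / real n) * ((1 + 1 / real n) powr (-a) - 1 + a / real n - a * (a + 1) / 2 / real n ^ 2)
          + a * a * (a + 1) / 2 * (1 / real n ^ 3)) \<in> O(\<lambda>n. 1 / real n ^ 3)" (is "?f \<in> _")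
  proof (intro sum_in_bigo)
    have "(\<lambda>n. 1 + a / real n) \<in> O(\<lambda>_. 1)" by real_asymp
    from landau_o.big.mult[OF this 1] show "(\<lambda>n. (1 + a / real n) * ((1 + 1 / real n) powr (-a) - 1 + a / real n
      - a * (a + 1) / 2 / real n ^ 2)) \<in> O(\<lambda>n. 1 / real n ^ 3)" by simp
    show "(\<lambda>n. a * a * (a + 1) / 2 * (1 / real n ^ 3)) \<in> O(\<lambda>n. 1 / real n ^ 3)"
      by (rule bigoI[of _ "\<bar>a * a * (a + 1) / 2\<bar>"]) (simp add: abs_mult)
  qed
  also have "?this \<longleftrightarrow> \<delta> \<in> O(\<lambda>n. 1 / real n ^ 3)"
    by (intro landau_o.big.in_cong eventually_mono[OF eventually_gt_at_top[of 0]])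
       (simp add: \<delta>_def c_def field_simps power2_eq_square power3_eq_cube)
  finally have \<delta>: "\<delta> \<in> O(\<lambda>n. 1 / real n ^ 3)" .
  have step: "eventually (\<lambda>n. w (Suc n) - w n = w n * (\<delta> n - c / real n ^ 2)) sequentially"
    using eventually_gt_at_top[of 0]
  proof eventually_elim
    case (elim n)
    have "real (Suc n) powr a = real n powr a * (1 + 1 / real n) powr a"
    proof -
      have "real (Suc n) = real n * (1 + 1 / real n)" using elim by (simp add: distrib_left)
      thus ?thesis using elim by (simp only: powr_mult)
    qed
    hence "w (Suc n) = w n * ((1 + a / real n) * (1 + 1 / real n) powr (-a))"
      using elim Gamma_quot_Suc[OF assms elim] by (simp add: w_def powr_minus field_simps)
    thus ?case by (simp add: \<delta>_def algebra_simps)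
  qed
  have w: "w \<longlonglongrightarrow> 1" unfolding w_def using assms by (rule Gamma_quot_lim)
  hence w1: "w \<in> O(\<lambda>_. 1)"
    by (intro bigoI_tendsto[of _ _ 1]) auto
  \<comment> \<open>Bootstrapping: boundedness of \<open>w\<close> gives \<open>w - 1 = O(1/n)\<close>, which makes the increments of
    \<open>w - 1 - c/n\<close> of order \<open>n\<^sup>-\<^sup>3\<close>.\<close>
  have p23: "(\<lambda>n. 1 / real n ^ 3) \<in> O(\<lambda>n. 1 / real n ^ 2)" by real_asymp
  have "(\<lambda>n. w n * (\<delta> n - c / real n ^ 2)) \<in> O(\<lambda>n. 1 * (1 / real n ^ 2))"
    by (intro landau_o.big.mult w1 sum_in_bigo landau_o.big.trans[OF \<delta> p23]) real_asymp
  hence d1: "(\<lambda>n. (w (Suc n) - 1) - (w n - 1)) \<in> O(\<lambda>n. 1 / real n ^ Suc 1)"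
    using landau_o.big.in_cong[OF step] by (simp add: numeral_2_eq_2)
  have l1: "(\<lambda>n. w n - 1) \<longlonglongrightarrow> 0"
    using w by (rule LIM_zero)
  have w2: "(\<lambda>n. w n - 1) \<in> O(\<lambda>n. 1 / real n ^ 1)"
    by (rule telescope_bigo[OF l1 d1 zero_less_one])
  \<comment> \<open>This is the increment of \<open>w n - 1 - c / n\<close>, rearranged; the last
    term is the discrepancy between \<open>c / n ^ 2\<close> and
    \<open>c / n - c / (n + 1)\<close>.\<close>
  have "(\<lambda>n. w n * \<delta> n - c * ((w n - 1) * (1 / real n ^ 2)) - c / (real n ^ 2 * (real n + 1)))
        \<in> O(\<lambda>n. 1 / real n ^ 3)"
  proof (intro sum_in_bigo)
    show "(\<lambda>n. w n * \<delta> n) \<in> O(\<lambda>n. 1 / real n ^ 3)"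
      using landau_o.big.mult[OF w1 \<delta>] by simp
    have "(\<lambda>n. (w n - 1) * (1 / real n ^ 2)) \<in> O(\<lambda>n. (1 / real n ^ 1) * (1 / real n ^ 2))"
      by (intro landau_o.big.mult w2) auto
    hence "(\<lambda>n. (w n - 1) * (1 / real n ^ 2)) \<in> O(\<lambda>n. 1 / real n ^ 3)"
      by (simp add: power3_eq_cube power2_eq_square mult.assoc)
    moreover have "(\<lambda>_. c) \<in> O(\<lambda>_::nat. 1::real)" by simp
    ultimately show "(\<lambda>n. c * ((w n - 1) * (1 / real n ^ 2))) \<in> O(\<lambda>n. 1 / real n ^ 3)"
      using landau_o.big.mult[of "\<lambda>_. c" sequentially "\<lambda>_. 1"] by fastforce
    show "(\<lambda>n. c / (real n ^ 2 * (real n + 1))) \<in> O(\<lambda>n. 1 / real n ^ 3)"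
      by real_asymp
  qed
  also have "?this \<longleftrightarrow> (\<lambda>n. (w (Suc n) - 1 - c / real (Suc n)) - (w n - 1 - c / real n)) \<in> O(\<lambda>n. 1 / real n ^ 3)"
  proof (rule landau_o.big.in_cong)
    show "\<forall>\<^sub>F n in sequentially.
       w n * \<delta> n - c * ((w n - 1) * (1 / real n ^ 2)) - c / (real n ^ 2 * (real n + 1)) =
       w (Suc n) - 1 - c / real (Suc n) - (w n - 1 - c / real n)"
      using step eventually_gt_at_top[of 0]
    proof eventually_elim
      case (elim n)
      have "c / real n - c / real (Suc n) = c / real n ^ 2 - c / (real n ^ 2 * (real n + 1))"
        using elim(2) by (simp add: divide_simps) algebra
      thus ?case using elim(1) by (simp add: algebra_simps diff_divide_distrib)
    qed
  qed
  finally have d2: "(\<lambda>n. (w (Suc n) - 1 - c / real (Suc n)) - (w n - 1 - c / real n)) \<in> O(\<lambda>n. 1 / real n ^ Suc 2)"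
    by (simp add: eval_nat_numeral)
  have l2: "(\<lambda>n. w n - 1 - c / real n) \<longlonglongrightarrow> 0"
    using tendsto_diff[OF LIM_zero[OF w] lim_const_over_n[of c]] by simp
  have "(\<lambda>n. w n - 1 - c / real n) \<in> O(\<lambda>n. 1 / real n ^ 2)"
    by (rule telescope_bigo[OF l2 d2 zero_less_numeral])
  thus ?thesis by (simp only: w_def c_def)
qed

text \<open>The finitely many early quotients are added to the constant. A bound for all positive
  \<open>n\<close> is required because (t - s)/h takes moderate values for \<open>s\<close> near
  \<open>t\<close>, however small \<open>h\<close> is.\<close>

lemma bigo_sequence_bound:
  fixes f g :: "nat \<Rightarrow> real"
  assumes "f \<in> O(g)" and "\<And>n. n > 0 \<Longrightarrow> g n > 0"
  obtains C where "C > 0" "\<And>n. n > 0 \<Longrightarrow> \<bar>f n\<bar> \<le> C * g n"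
proof -
  from assms(1) obtain C N where C: "C > 0" "\<And>n. n \<ge> N \<Longrightarrow> \<bar>f n\<bar> \<le> C * \<bar>g n\<bar>"
    unfolding bigo_def eventually_at_top_linorder by auto
  define D where "D = C + (\<Sum>n=1..N. \<bar>f n\<bar> / g n)"
  have S: "(\<Sum>n=1..N. \<bar>f n\<bar> / g n) \<ge> 0" using assms(2) by (intro sum_nonneg divide_nonneg_pos) auto
  have "\<bar>f n\<bar> \<le> D * g n" if "n > 0" for n
  proof (cases "n \<ge> N")
    case True
    thus ?thesis using C(2)[of n] S assms(2)[of n] that by (simp add: D_def distrib_right add_increasing2)
  next
    case False
    hence "\<bar>f n\<bar> / g n \<le> (\<Sum>n=1..N. \<bar>f n\<bar> / g n)"
      using that assms(2) by (intro member_le_sum) (auto intro: divide_nonneg_pos)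
    hence "\<bar>f n\<bar> / g n \<le> D" using C(1) by (simp add: D_def)
    thus ?thesis using assms(2)[OF that] by (simp add: divide_simps)
  qed
  moreover have "D > 0" using C(1) S by (simp add: D_def)
  ultimately show ?thesis using that by blast
qed

section \<open>The method applied to a truncated cube\<close>

text \<open>The moments turn the sum into \<open>w n\<close> times a quadratic in \<open>n\<close>.
  After division by \<open>6 * \<gamma> * n powr (1 - \<beta>)\<close> both sides are expanded in
  powers of \<open>n\<close>: the coefficients of n^2 and n agree, and what remains is bounded
  uniformly in \<open>\<theta>\<close>.\<close>

lemma sum_grunwald_cube_asymp_nat:
  fixes \<beta> :: real
  assumes "0 < \<beta>" "\<beta> \<le> 1"
  shows "\<exists>C\<ge>0. \<forall>n>0. \<forall>\<theta>. 0 \<le> \<theta> \<longrightarrow> \<theta> \<le> 1 \<longrightarrow>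
    \<bar>(\<Sum>k\<le>n. grunwald \<beta> k * (real n - real k + \<theta>) ^ 3) -
      6 / Gamma (4 - \<beta>) * ((n + \<theta>) powr (3 - \<beta>) - \<beta> * (3 - \<beta>) / 2 * (n + \<theta>) powr (2 - \<beta>))\<bar>
     \<le> C * real n powr (1 - \<beta>)"
proof -
  define w where "w = (\<lambda>n. Gamma_quot (1 - \<beta>) n / real n powr (1 - \<beta>))"
  define b where "b = \<beta> * (3 - \<beta>) / 2"
  define c where "c = - (\<beta> * (1 - \<beta>) / 2)"
  define \<gamma> where "\<gamma> = 1 / Gamma (4 - \<beta>)"
  have "(\<lambda>n. w n - 1 - c / real n) \<in> O(\<lambda>n. 1 / real n ^ 2)"
    using Gamma_quot_asymp[of "1 - \<beta>"] assms by (simp add: w_def c_def mult_ac)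
  then obtain C1 where C1: "\<And>n. n > 0 \<Longrightarrow> \<bar>w n - 1 - c / real n\<bar> \<le> C1 * (1 / real n ^ 2)"
    by (rule bigo_sequence_bound) auto
  obtain C3 where C3: "\<And>u. 0 \<le> u \<Longrightarrow> u \<le> 1 \<Longrightarrow>
      \<bar>(1 + u) powr (3 - \<beta>) - (\<Sum>m<2. ((3 - \<beta>) gchoose m) * u ^ m)\<bar> \<le> C3 * u ^ 2" "C3 \<ge> 0"
    using powr_Taylor_bound[where p = "3 - \<beta>" and n = 2 and b = 1] by blast
  obtain C2 where C2: "\<And>u. 0 \<le> u \<Longrightarrow> u \<le> 1 \<Longrightarrow>
      \<bar>(1 + u) powr (2 - \<beta>) - (\<Sum>m<1. ((2 - \<beta>) gchoose m) * u ^ m)\<bar> \<le> C2 * u ^ 1" "C2 \<ge> 0"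
    using powr_Taylor_bound[where p = "2 - \<beta>" and n = 1 and b = 1] by blast
  \<comment> \<open>Here 20 = 8 + 4 + 8 bounds \<open>d\<close>, \<open>c * e\<close> and
    \<open>c * d / x\<close>; 13 = 1 + 4 + 8 bounds \<open>1 + e / x + d / x ^ 2\<close>; the 2
    before \<open>C2\<close> bounds \<open>b\<close>.\<close>
  define K where "K = 20 + 13 * C1 + C3 + 2 * C2"
  have bnd: "\<bar>b\<bar> \<le> 2" "\<bar>c\<bar> \<le> 1"
  proof -
    have "\<beta> * (3 - \<beta>) \<le> 1 * 3" "0 \<le> \<beta> * (3 - \<beta>)" "\<beta> * (1 - \<beta>) \<le> 1 * 1" "0 \<le> \<beta> * (1 - \<beta>)"
      using assms mult_mono[of \<beta> 1 "3 - \<beta>" 3] mult_mono[of \<beta> 1 "1 - \<beta>" 1] by auto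
    thus "\<bar>b\<bar> \<le> 2" "\<bar>c\<bar> \<le> 1" by (auto simp: b_def c_def abs_le_iff)
  qed
  have main: "\<bar>(\<Sum>k\<le>n. grunwald \<beta> k * (real n - real k + \<theta>) ^ 3) -
      6 * \<gamma> * ((n + \<theta>) powr (3 - \<beta>) - b * (n + \<theta>) powr (2 - \<beta>))\<bar>
     \<le> \<bar>6 * \<gamma>\<bar> * K * real n powr (1 - \<beta>)" if n: "n > 0" and \<theta>: "0 \<le> \<theta>" "\<theta> \<le> 1" for n \<theta>
  proof -
    define x where "x = real n"
    define u where "u = \<theta> / x"
    define P where "P = x powr (1 - \<beta>)"
    have x: "x \<ge> 1" using n by (simp add: x_def)
    have P: "P > 0" using x by (simp add: P_def)
    have u: "0 \<le> u" "u \<le> 1" using x \<theta> by (auto simp: u_def field_simps)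
    \<comment> \<open>The sum will equal \<open>6 * R * (x ^ 2 + e * x + d)\<close>. A term with
      \<open>1 / x\<close>, from the zeroth moment, is left inside \<open>d\<close>; it is bounded
      since \<open>x \<ge> 1\<close>.\<close>
    define e where "e = \<theta> * (3 - \<beta>) - \<beta>"
    define d where "d = \<beta> * (1 + \<beta>) / 6 - \<theta> * (3 - \<beta>) * \<beta> / 2 + \<theta>\<^sup>2 / 2 * ((3 - \<beta>) * (2 - \<beta>))
        + \<theta> ^ 3 / 6 * ((3 - \<beta>) * (2 - \<beta>) * (1 - \<beta>)) / x"
    define \<rho> where "\<rho> = w n - 1 - c / x"
    define \<eta>3 where "\<eta>3 = (1 + u) powr (3 - \<beta>) - (1 + (3 - \<beta>) * u)"
    define \<eta>2 where "\<eta>2 = (1 + u) powr (2 - \<beta>) - 1"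
    have \<rho>: "\<bar>\<rho> * x\<^sup>2\<bar> \<le> C1"
    proof -
      have "\<bar>\<rho>\<bar> * x\<^sup>2 \<le> C1 * (1 / x\<^sup>2) * x\<^sup>2"
        using C1[OF n] by (intro mult_right_mono) (auto simp: \<rho>_def x_def)
      thus ?thesis using x by (simp add: abs_mult)
    qed
    have \<eta>3: "\<bar>\<eta>3 * x\<^sup>2\<bar> \<le> C3"
    proof -
      have "\<bar>\<eta>3\<bar> \<le> C3 * u\<^sup>2" using C3(1)[OF u] by (simp add: \<eta>3_def eval_nat_numeral)
      hence "\<bar>\<eta>3\<bar> * x\<^sup>2 \<le> C3 * u\<^sup>2 * x\<^sup>2" by (intro mult_right_mono) auto
      also have "\<dots> = C3 * \<theta>\<^sup>2" using x by (simp add: u_def power_divide)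
      also have "\<dots> \<le> C3 * 1" using \<theta> C3(2) by (intro mult_left_mono power_le_one) auto
      finally show ?thesis by (simp add: abs_mult)
    qed
    have \<eta>2: "\<bar>\<eta>2 * x\<bar> \<le> C2"
    proof -
      have "\<bar>\<eta>2\<bar> \<le> C2 * u" using C2(1)[OF u] by (simp add: \<eta>2_def)
      hence "\<bar>\<eta>2\<bar> * x \<le> C2 * u * x" using x by (intro mult_right_mono) auto
      also have "\<dots> = C2 * \<theta>" using x by (simp add: u_def)
      also have "\<dots> \<le> C2 * 1" using \<theta> C2(2) by (intro mult_left_mono) auto
      finally show ?thesis using x by (simp add: abs_mult)
    qed
    have ebnd: "\<bar>e\<bar> \<le> 4"
    proof -
      have "\<theta> * (3 - \<beta>) \<le> 1 * 3" "0 \<le> \<theta> * (3 - \<beta>)" using \<theta> assms mult_mono[of \<theta> 1 "3 - \<beta>" 3] by auto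
      thus ?thesis using assms by (auto simp: e_def abs_le_iff)
    qed
    have dbnd: "\<bar>d\<bar> \<le> 8"
    proof -
      have b2: "(3 - \<beta>) * (2 - \<beta>) \<le> 3 * 2" "0 \<le> (3 - \<beta>) * (2 - \<beta>)"
        using assms by (intro mult_mono mult_nonneg_nonneg; simp)+
      have b3: "(3 - \<beta>) * (2 - \<beta>) * (1 - \<beta>) \<le> 3 * 2 * 1" "0 \<le> (3 - \<beta>) * (2 - \<beta>) * (1 - \<beta>)"
        using assms by (intro mult_mono mult_nonneg_nonneg; simp)+
      have "\<beta> * (1 + \<beta>) \<le> 1 * 2" "0 \<le> \<beta> * (1 + \<beta>)" using assms by (intro mult_mono mult_nonneg_nonneg; simp)+
      moreover have "\<theta> * (3 - \<beta>) * \<beta> \<le> 1 * 3 * 1" "0 \<le> \<theta> * (3 - \<beta>) * \<beta>"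
        using assms \<theta> by (intro mult_mono mult_nonneg_nonneg; simp)+
      moreover have "\<theta>\<^sup>2 / 2 * ((3 - \<beta>) * (2 - \<beta>)) \<le> 1 / 2 * (3 * 2)" "0 \<le> \<theta>\<^sup>2 / 2 * ((3 - \<beta>) * (2 - \<beta>))"
        using assms b2 \<theta> by (intro mult_mono divide_right_mono power_le_one mult_nonneg_nonneg; simp)+
      moreover have "\<theta> ^ 3 / 6 * ((3 - \<beta>) * (2 - \<beta>) * (1 - \<beta>)) / x \<le> 1 / 6 * (3 * 2 * 1) / 1"
        "0 \<le> \<theta> ^ 3 / 6 * ((3 - \<beta>) * (2 - \<beta>) * (1 - \<beta>)) / x"
        using assms b3 \<theta> x by (intro frac_le mult_mono divide_right_mono power_le_one mult_nonneg_nonneg divide_nonneg_nonneg; simp)+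
      ultimately show ?thesis by (simp add: d_def abs_le_iff)
    qed
    have pw: "(x + \<theta>) powr (3 - \<beta>) = P * x\<^sup>2 * (1 + u) powr (3 - \<beta>)"
             "(x + \<theta>) powr (2 - \<beta>) = P * x * (1 + u) powr (2 - \<beta>)"
    proof -
      have *: "x + \<theta> = x * (1 + u)" using x by (simp add: u_def field_simps)
      have "x powr (3 - \<beta>) = x powr ((1 - \<beta>) + 2)" "x powr (2 - \<beta>) = x powr ((1 - \<beta>) + 1)"
        by simp_all
      hence "x powr (3 - \<beta>) = P * x\<^sup>2" "x powr (2 - \<beta>) = P * x"
        using x unfolding P_def by (simp_all only: powr_add) (simp_all add: powr_numeral)
      thus "(x + \<theta>) powr (3 - \<beta>) = P * x\<^sup>2 * (1 + u) powr (3 - \<beta>)"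
             "(x + \<theta>) powr (2 - \<beta>) = P * x * (1 + u) powr (2 - \<beta>)"
        unfolding * using x u by (simp_all add: powr_mult)
    qed
    define R where "R = Gamma_quot (1 - \<beta>) n / Gamma (4 - \<beta>)"
    have R: "R = \<gamma> * P * w n"
      using P by (simp add: \<gamma>_def R_def w_def x_def[symmetric] P_def)
    have "(\<Sum>k\<le>n. grunwald \<beta> k * (real n - real k + \<theta>) ^ 3) = 6 * R * (x\<^sup>2 + e * x + d)"
    proof -
      have g: "gmoment \<beta> 0 n = (3 - \<beta>) * (2 - \<beta>) * (1 - \<beta>) * R / x"
         "gmoment \<beta> 1 n = (3 - \<beta>) * (2 - \<beta>) * R"
         "gmoment \<beta> 2 n = 2 * (3 - \<beta>) * R * (x - \<beta> / 2)"
         "gmoment \<beta> 3 n = 6 * R * (x\<^sup>2 - \<beta> * x + \<beta> * (1 + \<beta>) / 6)"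
        using gmoment_eq[OF assms(2) n] unfolding R_def x_def by blast+
      show ?thesis unfolding sum_grunwald_cube g e_def d_def
        using x by (simp add: field_simps power2_eq_square power3_eq_cube)
    qed
    hence sum: "(\<Sum>k\<le>n. grunwald \<beta> k * (real n - real k + \<theta>) ^ 3) = 6 * \<gamma> * P * (w n * (x\<^sup>2 + e * x + d))"
      by (simp add: R mult_ac)
    have eq: "w n * (x\<^sup>2 + e * x + d) - (x\<^sup>2 * (1 + u) powr (3 - \<beta>) - b * (x * (1 + u) powr (2 - \<beta>)))
          = d + c * e + c * d / x + \<rho> * x\<^sup>2 * (1 + e / x + d / x\<^sup>2) - \<eta>3 * x\<^sup>2 + b * (\<eta>2 * x)"
    proof -
      have 1: "w n = 1 + c / x + \<rho>" by (simp add: \<rho>_def)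
      have 2: "(1 + u) powr (3 - \<beta>) = 1 + (3 - \<beta>) * u + \<eta>3" "(1 + u) powr (2 - \<beta>) = 1 + \<eta>2"
        by (simp_all add: \<eta>3_def \<eta>2_def)
      have 3: "x * u = \<theta>" using x by (simp add: u_def)
      have 4: "c / x * x = c" "c / x * x\<^sup>2 = c * x" "\<rho> * x\<^sup>2 * (e / x) = \<rho> * e * x" "\<rho> * x\<^sup>2 * (d / x\<^sup>2) = \<rho> * d"
        using x by (simp_all add: power2_eq_square)
      \<comment> \<open>The coefficient of \<open>x\<close> vanishes for every
        \<open>\<theta>\<close>; this identity determines \<open>b\<close>.\<close>
      have 5: "e + c - (3 - \<beta>) * \<theta> + b = 0"
        by (simp add: e_def c_def b_def field_simps)
      have "w n * (x\<^sup>2 + e * x + d) = x\<^sup>2 + e * x + d + c * x + c * e + c * d / x + \<rho> * x\<^sup>2 + \<rho> * e * x + \<rho> * d"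
        using 4(1,2) x unfolding 1 by (simp add: algebra_simps)
      moreover have "\<rho> * x\<^sup>2 * (1 + e / x + d / x\<^sup>2) = \<rho> * x\<^sup>2 + \<rho> * e * x + \<rho> * d"
        using 4(3,4) by (simp add: distrib_left)
      moreover have "x\<^sup>2 * (1 + u) powr (3 - \<beta>) = x\<^sup>2 + (3 - \<beta>) * \<theta> * x + \<eta>3 * x\<^sup>2"
        unfolding 2 3[symmetric] by (simp add: algebra_simps power2_eq_square)
      moreover have "b * (x * (1 + u) powr (2 - \<beta>)) = b * x + b * (\<eta>2 * x)"
        unfolding 2 by (simp add: algebra_simps)
      moreover have "(e + c - (3 - \<beta>) * \<theta> + b) * x = 0" unfolding 5 by simp
      ultimately show ?thesis by (simp only: distrib_right left_diff_distrib)
    qed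
    have "\<bar>c * e\<bar> \<le> 1 * 4" unfolding abs_mult using bnd ebnd by (intro mult_mono) auto
    moreover have "\<bar>c * d / x\<bar> \<le> 1 * 8 / 1" unfolding abs_mult abs_divide using bnd dbnd x
      by (intro frac_le mult_mono) auto
    moreover have "\<bar>\<rho> * x\<^sup>2 * (1 + e / x + d / x\<^sup>2)\<bar> \<le> C1 * 13"
    proof -
      have "\<bar>e / x\<bar> \<le> 4 / 1" "\<bar>d / x\<^sup>2\<bar> \<le> 8 / 1"
        unfolding abs_divide using ebnd dbnd x by (intro frac_le; simp)+
      hence "\<bar>1 + e / x + d / x\<^sup>2\<bar> \<le> 13" by linarith
      thus ?thesis unfolding abs_mult[of "\<rho> * x\<^sup>2"] using \<rho> by (intro mult_mono) auto
    qed
    moreover have "\<bar>b * (\<eta>2 * x)\<bar> \<le> 2 * C2"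
      unfolding abs_mult[of b] using bnd \<eta>2 by (intro mult_mono) auto
    ultimately have "\<bar>w n * (x\<^sup>2 + e * x + d) - (x\<^sup>2 * (1 + u) powr (3 - \<beta>) - b * (x * (1 + u) powr (2 - \<beta>)))\<bar> \<le> K"
      unfolding eq K_def using dbnd \<eta>3 by linarith
    hence "\<bar>6 * \<gamma>\<bar> * P * \<bar>w n * (x\<^sup>2 + e * x + d) - (x\<^sup>2 * (1 + u) powr (3 - \<beta>) - b * (x * (1 + u) powr (2 - \<beta>)))\<bar>
        \<le> \<bar>6 * \<gamma>\<bar> * P * K"
      using P by (intro mult_left_mono mult_nonneg_nonneg) auto
    also have "\<bar>6 * \<gamma>\<bar> * P * \<bar>w n * (x\<^sup>2 + e * x + d) - (x\<^sup>2 * (1 + u) powr (3 - \<beta>) - b * (x * (1 + u) powr (2 - \<beta>)))\<bar>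
       = \<bar>6 * \<gamma> * P * (w n * (x\<^sup>2 + e * x + d) - (x\<^sup>2 * (1 + u) powr (3 - \<beta>) - b * (x * (1 + u) powr (2 - \<beta>))))\<bar>"
      using P by (simp add: abs_mult)
    finally show ?thesis
      unfolding sum unfolding x_def[symmetric] unfolding pw P_def[symmetric]
      by (simp add: algebra_simps)
  qed
  have "K \<ge> 0"
    using C1[of 1] C2(2) C3(2) abs_ge_zero[of "w 1 - 1 - c / real 1"] unfolding K_def by (simp add: add_nonneg_nonneg)
  hence "\<bar>6 * \<gamma>\<bar> * K \<ge> 0" by simp
  with main show ?thesis unfolding \<gamma>_def b_def by (intro exI[of _ "\<bar>6 * \<gamma>\<bar> * K"]) (auto simp: \<gamma>_def)
qed

text \<open>Summands with \<open>k > X\<close> vanish, so any upper limit \<open>N \<ge> X\<close>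
  gives the same value. This later allows one \<open>N\<close> for all points of
  integration.\<close>

lemma sum_truncated_cube:
  fixes X :: real
  assumes "X \<ge> 0" "X \<le> real N"
  defines "n \<equiv> nat \<lfloor>X\<rfloor>"
  shows "(\<Sum>k\<le>N. c k * (max 0 (X - real k)) ^ 3) = (\<Sum>k\<le>n. c k * (real n - real k + (X - real n)) ^ 3)"
proof -
  have n: "real n \<le> X" "X < real n + 1"
    using assms(1) unfolding n_def by linarith+
  have "(\<Sum>k\<le>n. c k * (real n - real k + (X - real n)) ^ 3) = (\<Sum>k\<le>n. c k * (max 0 (X - real k)) ^ 3)"
  proof (intro sum.cong refl)
    fix k assume "k \<in> {..n}"
    hence "real k \<le> X" using n by simp
    thus "c k * (real n - real k + (X - real n)) ^ 3 = c k * (max 0 (X - real k)) ^ 3" by (simp add: max_def)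
  qed
  also have "\<dots> = (\<Sum>k\<le>N. c k * (max 0 (X - real k)) ^ 3)"
  proof (intro sum.mono_neutral_left ballI)
    show "{..n} \<subseteq> {..N}" using n assms(2) by auto
    fix k assume "k \<in> {..N} - {..n}"
    hence "real k \<ge> real n + 1" by auto
    thus "c k * (max 0 (X - real k)) ^ 3 = 0" using n by (simp add: max_def)
  qed auto
  finally show ?thesis ..
qed

text \<open>For \<open>X \<ge> 1\<close> this is the previous estimate at the integer and fractional
  parts of \<open>X\<close>. For \<open>X < 1\<close> every term is bounded, and the summand 1 in
  the error bound absorbs it.\<close>

lemma sum_grunwald_cube_asymp:
  fixes \<beta> :: real
  assumes "0 < \<beta>" "\<beta> \<le> 1"
  shows "\<exists>C\<ge>0. \<forall>X\<ge>0. \<forall>N::nat. X \<le> real N \<longrightarrow>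
    \<bar>(\<Sum>k\<le>N. grunwald \<beta> k * (max 0 (X - real k)) ^ 3) -
      6 / Gamma (4 - \<beta>) * (X powr (3 - \<beta>) - \<beta> * (3 - \<beta>) / 2 * X powr (2 - \<beta>))\<bar>
     \<le> C * (1 + X powr (1 - \<beta>))"
proof -
  obtain C where C: "C \<ge> 0" "\<And>n \<theta>. n > 0 \<Longrightarrow> 0 \<le> \<theta> \<Longrightarrow> \<theta> \<le> 1 \<Longrightarrow>
    \<bar>(\<Sum>k\<le>n. grunwald \<beta> k * (real n - real k + \<theta>) ^ 3) -
      6 / Gamma (4 - \<beta>) * ((n + \<theta>) powr (3 - \<beta>) - \<beta> * (3 - \<beta>) / 2 * (n + \<theta>) powr (2 - \<beta>))\<bar>
     \<le> C * real n powr (1 - \<beta>)"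
    using sum_grunwald_cube_asymp_nat[OF assms] by blast
  define G where "G = 6 / Gamma (4 - \<beta>)"
  define b where "b = \<beta> * (3 - \<beta>) / 2"
  define D where "D = C + 1 + \<bar>G\<bar> * (1 + \<bar>b\<bar>)"
  have "\<bar>(\<Sum>k\<le>N. grunwald \<beta> k * (max 0 (X - real k)) ^ 3) - G * (X powr (3 - \<beta>) - b * X powr (2 - \<beta>))\<bar>
     \<le> D * (1 + X powr (1 - \<beta>))" if X: "X \<ge> 0" "X \<le> real N" for X N
  proof -
    define n where "n = nat \<lfloor>X\<rfloor>"
    have n: "real n \<le> X" "X < real n + 1"
      using X unfolding n_def by linarith+
    have eq: "(\<Sum>k\<le>N. grunwald \<beta> k * (max 0 (X - real k)) ^ 3) =
        (\<Sum>k\<le>n. grunwald \<beta> k * (real n - real k + (X - real n)) ^ 3)"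
      unfolding n_def by (rule sum_truncated_cube[OF X])
    show ?thesis
    proof (cases "n = 0")
      case False
      have "\<bar>(\<Sum>k\<le>N. grunwald \<beta> k * (max 0 (X - real k)) ^ 3) - G * (X powr (3 - \<beta>) - b * X powr (2 - \<beta>))\<bar>
         \<le> C * real n powr (1 - \<beta>)"
        using C(2)[of n "X - real n"] False n unfolding eq G_def b_def by simp
      also have "\<dots> \<le> D * (1 + X powr (1 - \<beta>))"
        using n C(1) assms powr_mono2[of "1 - \<beta>" "real n" X]
        by (intro mult_mono) (auto simp: D_def intro: add_increasing)
      finally show ?thesis .
    next
      case True
      have X1: "X \<le> 1" using True n by simp
      have p: "\<bar>X powr p\<bar> \<le> 1" if "p \<ge> 0" for p
        using X1 X that powr_mono2[of p X 1] by simp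
      have "\<bar>(\<Sum>k\<le>N. grunwald \<beta> k * (max 0 (X - real k)) ^ 3) - G * (X powr (3 - \<beta>) - b * X powr (2 - \<beta>))\<bar>
          \<le> \<bar>X ^ 3\<bar> + \<bar>G\<bar> * (\<bar>X powr (3 - \<beta>)\<bar> + \<bar>b\<bar> * \<bar>X powr (2 - \<beta>)\<bar>)"
        unfolding eq True abs_mult[symmetric]
        by (simp add: order.trans[OF abs_triangle_ineq4] add_left_mono mult_left_mono abs_mult)
      also have "\<dots> \<le> 1 + \<bar>G\<bar> * (1 + \<bar>b\<bar> * 1)"
        using X X1 assms by (intro add_mono mult_left_mono p) (auto intro: power_le_one)
      also have "\<dots> \<le> D * 1" using C(1) by (simp add: D_def)
      also have "\<dots> \<le> D * (1 + X powr (1 - \<beta>))"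
        using C(1) by (intro mult_left_mono) (auto simp: D_def)
      finally show ?thesis .
    qed
  qed
  moreover have "D \<ge> 0" using C(1) by (simp add: D_def)
  ultimately show ?thesis unfolding G_def b_def by blast
qed

text \<open>The weights add up to 1, so the combination is
  \<open>S N X + \<beta> / 2 * (S N X - S N (X - 1))\<close>. To leading order the difference of
  \<open>X powr (3 - \<beta>)\<close> is \<open>(3 - \<beta>) * X powr (2 - \<beta>)\<close>, and
  \<open>\<beta> / 2\<close> times this is the term \<open>b * X powr (2 - \<beta>)\<close> to be
  removed.\<close>

lemma combined_kernel_asymp:
  fixes \<beta> :: real
  assumes "0 < \<beta>" "\<beta> \<le> 1"
  shows "\<exists>C\<ge>0. \<forall>X\<ge>0. \<forall>N::nat. X \<le> real N \<longrightarrow>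
    \<bar>(\<Sum>k\<le>N. grunwald \<beta> k * ((1 + \<beta> / 2) * (max 0 (X - real k)) ^ 3
          - \<beta> / 2 * (max 0 (X - real (k + 1))) ^ 3)) - 6 / Gamma (4 - \<beta>) * X powr (3 - \<beta>)\<bar>
     \<le> C * (1 + X powr (1 - \<beta>))"
proof -
  define G where "G = 6 / Gamma (4 - \<beta>)"
  define b where "b = \<beta> * (3 - \<beta>) / 2"
  define S where "S = (\<lambda>N X. \<Sum>k\<le>N. grunwald \<beta> k * (max 0 (X - real k)) ^ 3)"
  define T where "T = (\<lambda>X::real. G * (X powr (3 - \<beta>) - b * X powr (2 - \<beta>)))"
  obtain C where C: "C \<ge> 0" "\<And>X N. X \<ge> 0 \<Longrightarrow> X \<le> real N \<Longrightarrow> \<bar>S N X - T X\<bar> \<le> C * (1 + X powr (1 - \<beta>))"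
    using sum_grunwald_cube_asymp[OF assms] unfolding S_def T_def G_def b_def by blast
  obtain C3 where C3: "\<And>u. 0 \<le> u \<Longrightarrow> u \<le> 1 \<Longrightarrow>
      \<bar>(1 + u) powr (3 - \<beta>) - (\<Sum>m<2. ((3 - \<beta>) gchoose m) * u ^ m)\<bar> \<le> C3 * u ^ 2" "C3 \<ge> 0"
    using powr_Taylor_bound[where p = "3 - \<beta>" and n = 2 and b = 1] by blast
  obtain C2 where C2: "\<And>u. 0 \<le> u \<Longrightarrow> u \<le> 1 \<Longrightarrow>
      \<bar>(1 + u) powr (2 - \<beta>) - (\<Sum>m<1. ((2 - \<beta>) gchoose m) * u ^ m)\<bar> \<le> C2 * u ^ 1" "C2 \<ge> 0"
    using powr_Taylor_bound[where p = "2 - \<beta>" and n = 1 and b = 1] by blast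
  have b: "0 \<le> b" "b \<le> 2"
  proof -
    have "\<beta> * (3 - \<beta>) \<le> 1 * 3" "0 \<le> \<beta> * (3 - \<beta>)"
      using assms mult_mono[of \<beta> 1 "3 - \<beta>" 3] by auto
    thus "0 \<le> b" "b \<le> 2" by (auto simp: b_def)
  qed
  \<comment> \<open>With \<open>x = X - 1\<close> as base point, only powers of \<open>1 + u\<close>
    with \<open>u = 1 / x\<close> between 0 and 1 occur, as the Taylor bounds demand.\<close>
  have main_term: "\<bar>(1 + \<beta> / 2) * T (x + 1) - \<beta> / 2 * T x - G * (x + 1) powr (3 - \<beta>)\<bar> \<le>
      \<bar>G\<bar> * (C3 + 4 * C2) * x powr (1 - \<beta>)" if x: "x \<ge> 1" for x
  proof -
    define u where "u = 1 / x"
    define P where "P = x powr (1 - \<beta>)"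
    have P: "P > 0" using x by (simp add: P_def)
    have u: "0 \<le> u" "u \<le> 1" using x by (auto simp: u_def field_simps)
    define \<eta>3 where "\<eta>3 = (1 + u) powr (3 - \<beta>) - (1 + (3 - \<beta>) * u)"
    define \<eta>2 where "\<eta>2 = (1 + u) powr (2 - \<beta>) - 1"
    have "\<bar>\<eta>3\<bar> \<le> C3 * u\<^sup>2" using C3(1)[OF u] by (simp add: \<eta>3_def eval_nat_numeral)
    hence \<eta>3: "\<bar>\<eta>3 * x\<^sup>2\<bar> \<le> C3" using x by (simp add: abs_mult u_def field_simps)
    have "\<bar>\<eta>2\<bar> \<le> C2 * u" using C2(1)[OF u] by (simp add: \<eta>2_def)
    hence \<eta>2: "\<bar>\<eta>2 * x\<bar> \<le> C2" using x by (simp add: abs_mult u_def field_simps)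
    have "x powr (3 - \<beta>) = x powr ((1 - \<beta>) + 2)" "x powr (2 - \<beta>) = x powr ((1 - \<beta>) + 1)"
      by simp_all
    hence xp: "x powr (3 - \<beta>) = P * x\<^sup>2" "x powr (2 - \<beta>) = P * x"
      using x unfolding P_def by (simp_all only: powr_add) (simp_all add: powr_numeral)
    have *: "x + 1 = x * (1 + u)" using x by (simp add: u_def field_simps)
    have "(x + 1) powr (3 - \<beta>) = P * x\<^sup>2 * (1 + (3 - \<beta>) * u + \<eta>3)"
      unfolding * using x u by (simp add: powr_mult xp \<eta>3_def)
    hence p3: "(x + 1) powr (3 - \<beta>) = P * (x\<^sup>2 + (3 - \<beta>) * x + \<eta>3 * x\<^sup>2)"
      using x by (simp add: u_def algebra_simps power2_eq_square)
    have "(x + 1) powr (2 - \<beta>) = P * x * (1 + \<eta>2)"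
      unfolding * using x u by (simp add: powr_mult xp \<eta>2_def)
    hence p2: "(x + 1) powr (2 - \<beta>) = P * (x + \<eta>2 * x)"
      by (simp add: algebra_simps)
    have "(1 + \<beta> / 2) * T (x + 1) - \<beta> / 2 * T x - G * (x + 1) powr (3 - \<beta>) =
       G * P * (\<beta> / 2 * (\<eta>3 * x\<^sup>2) - (1 + \<beta> / 2) * b * (\<eta>2 * x))"
      unfolding T_def p3 p2 xp by (simp add: b_def field_simps power2_eq_square)
    also have "\<bar>\<dots>\<bar> = \<bar>G\<bar> * P * \<bar>\<beta> / 2 * (\<eta>3 * x\<^sup>2) - (1 + \<beta> / 2) * b * (\<eta>2 * x)\<bar>"
      using P by (simp add: abs_mult)
    also have "\<dots> \<le> \<bar>G\<bar> * P * (C3 + 4 * C2)"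
    proof (intro mult_left_mono)
      have "\<bar>\<beta> / 2 * (\<eta>3 * x\<^sup>2)\<bar> \<le> 1 * C3"
        unfolding abs_mult[of "\<beta> / 2"] using assms \<eta>3 by (intro mult_mono) auto
      moreover have "\<bar>(1 + \<beta> / 2) * b * (\<eta>2 * x)\<bar> \<le> (2 * 2) * C2"
      proof -
        have "\<bar>(1 + \<beta> / 2) * b\<bar> \<le> 2 * 2"
          unfolding abs_mult using assms b by (intro mult_mono) auto
        thus ?thesis unfolding abs_mult[of "(1 + \<beta> / 2) * b"] using \<eta>2 by (intro mult_mono) auto
      qed
      ultimately show "\<bar>\<beta> / 2 * (\<eta>3 * x\<^sup>2) - (1 + \<beta> / 2) * b * (\<eta>2 * x)\<bar> \<le> C3 + 4 * C2"
        by linarith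
    qed (use P in auto)
    finally show ?thesis by (simp add: P_def mult_ac)
  qed
  \<comment> \<open>The case \<open>X \<ge> 2\<close> costs
    \<open>3 * C + \<bar>G\<bar> * (C3 + 4 * C2)\<close>, the case \<open>X < 2\<close> costs
    \<open>9 * C + 80 * \<bar>G\<bar>\<close>; \<open>D\<close> majorises both.\<close>
  define D where "D = 12 * C + \<bar>G\<bar> * (C3 + 4 * C2) + 100 * \<bar>G\<bar>"
  have D: "D \<ge> 0" using C(1) C2(2) C3(2) by (simp add: D_def)
  have "\<bar>(1 + \<beta> / 2) * S N X - \<beta> / 2 * S N (X - 1) - G * X powr (3 - \<beta>)\<bar> \<le> D * (1 + X powr (1 - \<beta>))"
    if X: "X \<ge> 0" "X \<le> real N" for X N
  proof (cases "X \<ge> 2")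
    case True
    define P where "P = X powr (1 - \<beta>)"
    have P: "(X - 1) powr (1 - \<beta>) \<le> P" "P \<ge> 0"
      unfolding P_def using True assms by (auto intro!: powr_mono2)
    have 1: "\<bar>S N X - T X\<bar> \<le> C * (1 + P)"
      using C(2)[OF X] by (simp add: P_def)
    have 2: "\<bar>S N (X - 1) - T (X - 1)\<bar> \<le> C * (1 + P)"
      using C(2)[of "X - 1" N] X True P C(1) by (auto elim!: order.trans intro!: mult_left_mono)
    have "\<bar>(1 + \<beta> / 2) * T X - \<beta> / 2 * T (X - 1) - G * X powr (3 - \<beta>)\<bar> \<le>
        \<bar>G\<bar> * (C3 + 4 * C2) * (X - 1) powr (1 - \<beta>)"
      using main_term[of "X - 1"] True by simp
    also have "\<dots> \<le> \<bar>G\<bar> * (C3 + 4 * C2) * (1 + P)"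
      using P C2(2) C3(2) by (intro mult_left_mono) auto
    finally have 3: "\<bar>(1 + \<beta> / 2) * T X - \<beta> / 2 * T (X - 1) - G * X powr (3 - \<beta>)\<bar> \<le> \<bar>G\<bar> * (C3 + 4 * C2) * (1 + P)" .
    have 4: "\<bar>(1 + \<beta> / 2) * (S N X - T X)\<bar> \<le> 2 * (C * (1 + P))"
      unfolding abs_mult using 1 assms by (intro mult_mono) auto
    have 5: "\<bar>\<beta> / 2 * (S N (X - 1) - T (X - 1))\<bar> \<le> 1 * (C * (1 + P))"
      unfolding abs_mult using 2 assms by (intro mult_mono) auto
    have "\<bar>(1 + \<beta> / 2) * S N X - \<beta> / 2 * S N (X - 1) - G * X powr (3 - \<beta>)\<bar> \<le>
       2 * (C * (1 + P)) + 1 * (C * (1 + P)) + \<bar>G\<bar> * (C3 + 4 * C2) * (1 + P)"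
      using 3 4 5 unfolding right_diff_distrib by linarith
    also have "\<dots> = (3 * C + \<bar>G\<bar> * (C3 + 4 * C2)) * (1 + P)" by (simp add: algebra_simps)
    also have "\<dots> \<le> D * (1 + P)" using P C(1) by (intro mult_right_mono) (auto simp: D_def)
    finally show ?thesis by (simp add: P_def)
  next
    case False
    have p: "\<bar>Y powr q\<bar> \<le> 8" if "0 \<le> Y" "Y < 2" "0 \<le> q" "q \<le> 3" for Y q :: real
    proof -
      have "Y powr q \<le> 2 powr q" using that by (intro powr_mono2) auto
      also have "\<dots> \<le> 2 powr 3" using that by (intro powr_mono) auto
      finally show ?thesis by simp
    qed
    have Sb: "\<bar>S N Y\<bar> \<le> C * 3 + \<bar>G\<bar> * 24" if Y: "Y < 2" "Y \<le> real N" for Y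
    proof (cases "Y \<ge> 0")
      case True
      have "Y powr (1 - \<beta>) \<le> 2"
      proof -
        have "Y powr (1 - \<beta>) \<le> 2 powr (1 - \<beta>)" using True Y assms by (intro powr_mono2) auto
        also have "\<dots> \<le> 2 powr 1" using assms by (intro powr_mono) auto
        finally show ?thesis by simp
      qed
      hence "C * (1 + Y powr (1 - \<beta>)) \<le> C * 3" using C(1) by (intro mult_left_mono) auto
      hence 1: "\<bar>S N Y - T Y\<bar> \<le> C * 3" using C(2)[OF True Y(2)] by linarith
      have "\<bar>b * Y powr (2 - \<beta>)\<bar> \<le> 2 * 8"
        unfolding abs_mult using b True Y assms by (intro mult_mono p) auto
      hence "\<bar>Y powr (3 - \<beta>) - b * Y powr (2 - \<beta>)\<bar> \<le> 24"
        using p[of Y "3 - \<beta>"] True Y assms by linarith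
      hence "\<bar>T Y\<bar> \<le> \<bar>G\<bar> * 24" unfolding T_def abs_mult by (intro mult_left_mono) auto
      with 1 show ?thesis by linarith
    next
      case False
      hence "S N Y = 0" unfolding S_def by (intro sum.neutral) (auto simp: max_def)
      thus ?thesis using C(1) by simp
    qed
    have 1: "\<bar>(1 + \<beta> / 2) * S N X\<bar> \<le> 2 * (C * 3 + \<bar>G\<bar> * 24)"
      unfolding abs_mult using Sb[of X] False X assms by (intro mult_mono) auto
    have 2: "\<bar>\<beta> / 2 * S N (X - 1)\<bar> \<le> 1 * (C * 3 + \<bar>G\<bar> * 24)"
      unfolding abs_mult using Sb[of "X - 1"] False X assms by (intro mult_mono) auto
    have 3: "\<bar>G * X powr (3 - \<beta>)\<bar> \<le> \<bar>G\<bar> * 8"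
      unfolding abs_mult using p[of X "3 - \<beta>"] False X assms by (intro mult_left_mono) auto
    have triangle: "\<bar>p - q - r\<bar> \<le> \<bar>p\<bar> + \<bar>q\<bar> + \<bar>r\<bar>" for p q r :: real by linarith
    have "0 \<le> \<bar>G\<bar> * (C3 + 4 * C2)" using C2(2) C3(2) by simp
    hence "2 * (C * 3 + \<bar>G\<bar> * 24) + 1 * (C * 3 + \<bar>G\<bar> * 24) + \<bar>G\<bar> * 8 \<le> D * 1"
      using C(1) by (simp add: D_def)
    with order.trans[OF triangle add_mono[OF add_mono[OF 1 2] 3]]
    have "\<bar>(1 + \<beta> / 2) * S N X - \<beta> / 2 * S N (X - 1) - G * X powr (3 - \<beta>)\<bar> \<le> D * 1"
      by (rule order.trans)
    also have "\<dots> \<le> D * (1 + X powr (1 - \<beta>))" using D by (intro mult_left_mono) auto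
    finally show ?thesis .
  qed
  moreover have "(\<Sum>k\<le>N. grunwald \<beta> k * ((1 + \<beta> / 2) * (max 0 (X - real k)) ^ 3
          - \<beta> / 2 * (max 0 (X - real (k + 1))) ^ 3)) = (1 + \<beta> / 2) * S N X - \<beta> / 2 * S N (X - 1)" for N X
    unfolding S_def sum_distrib_left sum_subtractf[symmetric]
    by (intro sum.cong) (auto simp: algebra_simps)
  ultimately show ?thesis using D unfolding G_def by auto
qed

section \<open>Abel integrals and the Riemann-Liouville derivative\<close>

text \<open>For \<open>a > -1\<close> this is \<open>Gamma (a + 1)\<close> times the
  Riemann-Liouville integral of order \<open>a + 1\<close> based at 0.\<close>

definition abel_int :: "(real \<Rightarrow> real) \<Rightarrow> real \<Rightarrow> real \<Rightarrow> real" where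
  "abel_int f a s = integral {0..s} (\<lambda>\<tau>. f \<tau> * (s - \<tau>) powr a)"

text \<open>Integration by parts; the boundary terms vanish by \<open>f 0 = 0\<close> and
  \<open>a + 1 > 0\<close>. The form with \<open>has_integral\<close> also supplies the
  integrability against a singular kernel that \<open>has_RL_derivative\<close> asserts.\<close>

lemma has_integral_abel_int_parts:
  assumes f: "\<And>x. (f has_real_derivative f' x) (at x)" and f': "continuous_on UNIV f'"
    and "f 0 = 0" "a > -1" "s \<ge> 0"
  shows "((\<lambda>\<tau>. f \<tau> * (s - \<tau>) powr a) has_integral abel_int f' (a + 1) s / (a + 1)) {0..s}"
proof -
  define G where "G = (\<lambda>\<tau>. - f \<tau> * (s - \<tau>) powr (a + 1) / (a + 1))"
  have cf: "continuous_on A f" for A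
    using f by (meson DERIV_continuous continuous_at_imp_continuous_on)
  have cf': "continuous_on A f'" for A
    using f' continuous_on_subset by blast
  have cp: "continuous_on {0..s} (\<lambda>\<tau>. (s - \<tau>) powr (a + 1))"
    using assms by (intro continuous_intros continuous_on_powr') auto
  have 1: "((\<lambda>\<tau>. f \<tau> * (s - \<tau>) powr a - f' \<tau> * (s - \<tau>) powr (a + 1) / (a + 1)) has_integral G s - G 0) {0..s}"
  \<comment> \<open>For \<open>a < 0\<close> the factor \<open>(s - \<tau>) powr (a + 1)\<close> is
    not differentiable at \<open>\<tau> = s\<close>.\<close>
  proof (rule fundamental_theorem_of_calculus_interior)
    show "continuous_on {0..s} G"
      unfolding G_def using assms by (intro continuous_intros cf cp) auto
    fix x assume x: "x \<in> {0<..<s}"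
    have "a + 1 \<noteq> 0" using assms(4) by simp
    have "((\<lambda>\<tau>. (s - \<tau>) powr (a + 1)) has_real_derivative - ((a + 1) * (s - x) powr a)) (at x)"
      using x by (auto intro!: derivative_eq_intros)
    hence "((\<lambda>\<tau>. - (f \<tau> * (s - \<tau>) powr (a + 1))) has_real_derivative
        (a + 1) * (f x * (s - x) powr a) - f' x * (s - x) powr (a + 1)) (at x)"
      using DERIV_minus[OF DERIV_mult[OF f[of x]]] by (force simp: algebra_simps)
    from DERIV_cdivide[OF this, of "a + 1"]
    have "(G has_real_derivative (f x * (s - x) powr a - f' x * (s - x) powr (a + 1) / (a + 1))) (at x)"
      unfolding diff_divide_distrib using \<open>a + 1 \<noteq> 0\<close> by (simp add: G_def)
    thus "(G has_vector_derivative (f x * (s - x) powr a - f' x * (s - x) powr (a + 1) / (a + 1))) (at x)"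
      by (simp add: has_real_derivative_iff_has_vector_derivative)
  qed (use assms in auto)
  have "(\<lambda>\<tau>. f' \<tau> * (s - \<tau>) powr (a + 1)) integrable_on {0..s}"
    by (intro integrable_continuous_interval continuous_intros cf' cp)
  hence 2: "((\<lambda>\<tau>. f' \<tau> * (s - \<tau>) powr (a + 1) / (a + 1)) has_integral abel_int f' (a + 1) s / (a + 1)) {0..s}"
    unfolding abel_int_def by (intro has_integral_divide integrable_integral)
  from has_integral_add[OF 1 2] show ?thesis
    using assms(3) by (simp add: G_def)
qed

lemma abel_int_parts:
  assumes "\<And>x. (f has_real_derivative f' x) (at x)" "continuous_on UNIV f'"
    "f 0 = 0" "a > -1" "s \<ge> 0"
  shows "abel_int f a s = abel_int f' (a + 1) s / (a + 1)"
  unfolding abel_int_def[of f] using has_integral_abel_int_parts[OF assms] by (rule integral_unique)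

lemma eq_abel_int_deriv:
  assumes f: "\<And>x. (f has_real_derivative f' x) (at x)" and "f 0 = 0" "s \<ge> 0"
  shows "f s = abel_int f' 0 s"
proof -
  have "(f' has_integral f s - f 0) {0..s}"
    using assms(3) f by (intro fundamental_theorem_of_calculus)
      (auto intro: has_vector_derivative_at_within simp: has_real_derivative_iff_has_vector_derivative)
  \<comment> \<open>Since \<open>0 powr 0 = 0\<close>, the new integrand is 0 at
    \<open>\<tau> = s\<close> instead of \<open>f' s\<close>; a single point does not affect the
    integral.\<close>
  hence "((\<lambda>\<tau>. f' \<tau> * (s - \<tau>) powr 0) has_integral f s - f 0) {0..s}"
    by (rule has_integral_spike_finite[of "{s}", rotated 2]) auto
  thus ?thesis using assms(2) by (simp add: abel_int_def integral_unique)
qed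

text \<open>Substituting \<open>w = s - \<tau>\<close> removes \<open>s\<close> from the kernel, and
  because \<open>f\<close> vanishes on the left, the upper limit can be fixed independently of
  \<open>s\<close>. This prepares differentiation in \<open>s\<close>.\<close>

lemma abel_int_reflect:
  assumes "continuous_on UNIV f" "\<And>x. x \<le> 0 \<Longrightarrow> f x = 0" "a > 0" "0 \<le> s" "s \<le> T"
  shows "integral {0..T} (\<lambda>w. f (s - w) * w powr a) = abel_int f a s"
proof -
  define g where "g = (\<lambda>w. f (s - w) * w powr a)"
  have cg: "continuous_on {0..u} g" for u
    unfolding g_def using assms(3)
    by (intro continuous_intros continuous_on_powr' continuous_on_compose2[OF assms(1)]) auto
  have "integral {0..T} g = integral {0..s} g + integral {s..T} g"
    using assms by (intro Henstock_Kurzweil_Integration.integral_combine[symmetric] integrable_continuous_interval cg) auto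
  also have "integral {s..T} g = integral {s..T} (\<lambda>_. 0)"
    by (rule integral_cong) (auto simp: g_def assms(2))
  also have "integral {0..s} g = integral {-s..0} (g \<circ> (\<lambda>x. x + s))"
    using integral_shift[of "-s" s 0 g] cg by simp
  also have "\<dots> = abel_int f a s"
    using Henstock_Kurzweil_Integration.integral_reflect_real[of s 0 "\<lambda>\<tau>. f \<tau> * (s - \<tau>) powr a"]
    by (simp add: abel_int_def g_def o_def add_ac)
  finally show ?thesis by (simp add: g_def)
qed

text \<open>In reflected form only \<open>f\<close> depends on \<open>s\<close>, and the interval
  \<open>{0..2 * t}\<close> serves all \<open>s\<close> near \<open>t\<close>, so the Leibniz rule
  applies; \<open>a > 0\<close> makes the kernel continuous.\<close>

lemma abel_int_has_derivative:
  assumes f: "\<And>x. (f has_real_derivative f' x) (at x)" and f': "continuous_on UNIV f'"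
    and f0: "\<And>x. x \<le> 0 \<Longrightarrow> f x = 0" "\<And>x. x \<le> 0 \<Longrightarrow> f' x = 0" and "a > 0" "t > 0"
  shows "(abel_int f a has_real_derivative abel_int f' a t) (at t)"
proof -
  have cf: "continuous_on UNIV f"
    using f by (meson DERIV_continuous continuous_at_imp_continuous_on)
  let ?F = "\<lambda>s. integral (cbox 0 (2 * t)) (\<lambda>w. f (s - w) * w powr a)"
  have "(?F has_real_derivative integral (cbox 0 (2 * t)) (\<lambda>w. f' (t - w) * w powr a)) (at t within {0<..<2*t})"
  proof (rule leibniz_rule_field_derivative)
    fix x w :: real
    show "((\<lambda>x. f (x - w) * w powr a) has_real_derivative f' (x - w) * w powr a) (at x within {0<..<2*t})"
      by (auto intro!: derivative_eq_intros DERIV_chain2[OF f])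
  next
    fix x :: real
    show "(\<lambda>w. f (x - w) * w powr a) integrable_on cbox 0 (2 * t)"
      using \<open>a > 0\<close> unfolding cbox_interval
      by (intro integrable_continuous_interval continuous_intros continuous_on_powr'
            continuous_on_compose2[OF cf]) auto
  next
    show "continuous_on ({0<..<2*t} \<times> cbox 0 (2*t)) (\<lambda>(x, w). f' (x - w) * w powr a)"
      using \<open>a > 0\<close> unfolding cbox_interval split_beta
      by (intro continuous_intros continuous_on_powr' continuous_on_compose2[OF f']) auto
  qed (use \<open>t > 0\<close> in auto)
  moreover have "at t within {0<..<2*t} = at t"
    using \<open>t > 0\<close> by (intro at_within_open) auto
  moreover have "integral (cbox 0 (2 * t)) (\<lambda>w. f' (t - w) * w powr a) = abel_int f' a t"
    using abel_int_reflect[OF f' f0(2) \<open>a > 0\<close>, of t "2*t"] \<open>t > 0\<close> by (simp add: cbox_interval)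
  moreover have "eventually (\<lambda>s. ?F s = abel_int f a s) (nhds t)"
  proof (rule eventually_nhds_in_open[THEN eventually_mono])
    show "open {0<..<2*t}" "t \<in> {0<..<2*t}" using \<open>t > 0\<close> by auto
    fix s assume "s \<in> {0<..<2*t}"
    thus "?F s = abel_int f a s"
      using abel_int_reflect[OF cf f0(1) \<open>a > 0\<close>, of s "2*t"] by (simp add: cbox_interval)
  qed
  ultimately show ?thesis by (subst DERIV_cong_ev[OF refl _ refl, of _ ?F]) (auto elim: eventually_mono)
qed

section \<open>Smooth functions vanishing on the left half-line\<close>

lemma deriv_zero_of_zero_left:
  fixes f :: "real \<Rightarrow> real"
  assumes "(f has_real_derivative d) (at x)" "\<And>x. x \<le> 0 \<Longrightarrow> f x = 0" "x \<le> 0"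
  shows "d = 0"
proof -
  have "((\<lambda>h. (f (x + h) - f x) / h) \<longlongrightarrow> d) (at_left 0)"
    using assms(1) unfolding DERIV_def by (rule tendsto_within_subset) simp
  moreover have "eventually (\<lambda>h. (f (x + h) - f x) / h = 0) (at_left 0)"
    using eventually_at_left_real[of "-1" "0::real", OF less_minus_one_simps(1)]
  proof eventually_elim
    case (elim h)
    thus ?case using assms(2)[of x] assms(2)[of "x + h"] assms(3) by simp
  qed
  ultimately have "((\<lambda>_. 0) \<longlongrightarrow> d) (at_left (0::real))"
    by (rule Lim_transform_eventually)
  from tendsto_unique[OF trivial_limit_at_left_real this tendsto_const] show ?thesis .
qed

lemma C_m_derivs:
  assumes "C_m m y" "\<And>t. t \<le> 0 \<Longrightarrow> y t = 0"
  shows "\<And>j x. j < m \<Longrightarrow> ((deriv ^^ j) y has_real_derivative (deriv ^^ Suc j) y x) (at x)"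
    and "\<And>j. j \<le> m \<Longrightarrow> continuous_on UNIV ((deriv ^^ j) y)"
    and "\<And>j x. j \<le> m \<Longrightarrow> x \<le> 0 \<Longrightarrow> (deriv ^^ j) y x = 0"
proof -
  show D: "((deriv ^^ j) y has_real_derivative (deriv ^^ Suc j) y x) (at x)" if "j < m" for j x
    using assms(1) that by (simp add: C_m_def DERIV_deriv_iff_field_differentiable)
  show "continuous_on UNIV ((deriv ^^ j) y)" if "j \<le> m" for j
  proof (cases "j = m")
    case False
    with that D[of j] show ?thesis
      by (meson DERIV_continuous continuous_at_imp_continuous_on le_neq_implies_less)
  qed (use assms(1) in \<open>simp add: C_m_def\<close>)
  show "(deriv ^^ j) y x = 0" if "j \<le> m" "x \<le> 0" for j x
    using that
  proof (induction j arbitrary: x)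
    case (Suc j)
    show ?case using deriv_zero_of_zero_left[OF D[of j x] Suc.IH] Suc.prems by simp
  qed (simp add: assms(2))
qed

text \<open>Taylor's formula at 0 with integral remainder, all Taylor coefficients being zero. The
  integrations by parts at exponents 0, 1, 2 contribute the divisors 1, 2, 3.\<close>

lemma abel_int_representation:
  assumes y: "C_m 4 y" "\<And>t. t \<le> 0 \<Longrightarrow> y t = 0" and "s \<ge> 0"
  shows "y s = abel_int ((deriv ^^ 4) y) 3 s / 6"
proof -
  note D = C_m_derivs[OF y]
  define Y where "Y = (\<lambda>j. (deriv ^^ j) y)"
  have parts: "abel_int (Y j) a s = abel_int (Y (Suc j)) (a + 1) s / (a + 1)" if "j < 4" "a > -1" for j a
    unfolding Y_def using that assms(3) by (intro abel_int_parts D) auto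
  have num: "Suc 2 = 3" "Suc 3 = 4" by simp_all
  have "y s = abel_int (Y 1) 0 s"
    unfolding Y_def using D(1)[of 0] y(2)[of 0] assms(3) by (intro eq_abel_int_deriv) auto
  also have "\<dots> = abel_int (Y 2) 1 s"
    using parts[of 1 0] by (simp add: numeral_2_eq_2)
  also have "\<dots> = abel_int (Y 4) 3 s / 6"
    using parts[of 2 1] parts[of 3 2] by (simp add: num)
  finally show ?thesis by (simp only: Y_def)
qed

text \<open>For \<open>\<beta> < 1\<close> an integration by parts precedes the differentiation and
  raises the exponent from \<open>-\<beta>\<close> to \<open>1 - \<beta> > 0\<close>, as
  \<open>abel_int_has_derivative\<close> requires. Two more follow; the divisors
  \<open>1 - \<beta>\<close>, \<open>2 - \<beta>\<close>, \<open>3 - \<beta>\<close> combine with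
  \<open>Gamma (1 - \<beta>)\<close> to \<open>Gamma (4 - \<beta>)\<close>.\<close>

lemma has_RL_derivative_abel_int:
  assumes y: "C_m 4 y" "\<And>t. t \<le> 0 \<Longrightarrow> y t = 0" and "0 < \<beta>" "\<beta> \<le> 1" "t > 0"
  shows "has_RL_derivative \<beta> y (abel_int ((deriv ^^ 4) y) (3 - \<beta>) t / Gamma (4 - \<beta>)) t"
proof -
  note D = C_m_derivs[OF y]
  define Y where "Y = (\<lambda>j. (deriv ^^ j) y)"
  have parts: "abel_int (Y j) a s = abel_int (Y (Suc j)) (a + 1) s / (a + 1)"
    if "j < 4" "a > -1" "s \<ge> 0" for j a s
    unfolding Y_def using that by (intro abel_int_parts D) auto
  have num: "Suc 2 = 3" "Suc 3 = 4" by simp_all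
  show ?thesis
  proof (cases "\<beta> = 1")
    case True
    have "Y 1 t = abel_int (Y 2) 0 t"
      unfolding Y_def numeral_2_eq_2 using D(1)[of 1] D(3)[of 1 0] assms(5)
      by (intro eq_abel_int_deriv) auto
    also have "\<dots> = abel_int (Y 4) 2 t / 2"
      using parts[of 2 0 t] parts[of 3 1 t] assms(5) by (simp add: num)
    finally have "Y 1 t = abel_int (Y 4) 2 t / 2" .
    moreover have "(y has_real_derivative Y 1 t) (at t)"
      using D(1)[of 0 t] by (simp add: Y_def)
    ultimately have "(y has_real_derivative abel_int (Y 4) 2 t / 2) (at t)"
      by (simp only:)
    thus ?thesis using True Gamma_fact[of 2, where 'a = real]
      by (simp add: has_RL_derivative_def Y_def)
  next
    case False
    hence \<beta>: "\<beta> < 1" using assms by simp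
    define I where "I = (\<lambda>s. integral {0..s} (\<lambda>\<tau>. y \<tau> / (s - \<tau>) powr \<beta>))"
    have int: "((\<lambda>\<tau>. y \<tau> / (s - \<tau>) powr \<beta>) has_integral abel_int (Y 1) (1 - \<beta>) s / (1 - \<beta>)) {0..s}"
      if "s > 0" for s
    proof -
      have "((\<lambda>\<tau>. y \<tau> * (s - \<tau>) powr (-\<beta>)) has_integral abel_int (Y 1) (-\<beta> + 1) s / (-\<beta> + 1)) {0..s}"
        using that \<beta> D(1)[of 0] D(2)[of 1] y(2)[of 0]
        by (intro has_integral_abel_int_parts) (auto simp: Y_def)
      thus ?thesis by (simp add: powr_minus divide_inverse)
    qed
    have "((\<lambda>s. abel_int (Y 1) (1 - \<beta>) s / (1 - \<beta>)) has_real_derivative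
             abel_int (Y (Suc 1)) (1 - \<beta>) t / (1 - \<beta>)) (at t)"
      unfolding Y_def using \<beta> assms by (intro DERIV_cdivide abel_int_has_derivative D) auto
    moreover have "eventually (\<lambda>s. I s = abel_int (Y 1) (1 - \<beta>) s / (1 - \<beta>)) (nhds t)"
      using eventually_nhds_in_open[of "{0<..}" t] assms(5)
      by (auto elim!: eventually_mono simp: I_def integral_unique[OF int])
    ultimately have dI: "(I has_real_derivative abel_int (Y 2) (1 - \<beta>) t / (1 - \<beta>)) (at t)"
      by (subst DERIV_cong_ev[OF refl _ refl]) (auto simp: numeral_2_eq_2)
    have "abel_int (Y 2) (1 - \<beta>) t = abel_int (Y 4) (3 - \<beta>) t / (3 - \<beta>) / (2 - \<beta>)"
      using parts[of 2 "1 - \<beta>" t] parts[of 3 "2 - \<beta>" t] \<beta> assms(5) by (simp add: num)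
    moreover have "Gamma (4 - \<beta>) = (3 - \<beta>) * ((2 - \<beta>) * ((1 - \<beta>) * Gamma (1 - \<beta>)))"
    proof -
      have "1 - \<beta> \<notin> \<int>\<^sub>\<le>\<^sub>0" "2 - \<beta> \<notin> \<int>\<^sub>\<le>\<^sub>0" "3 - \<beta> \<notin> \<int>\<^sub>\<le>\<^sub>0"
        using \<beta> nonpos_Ints_nonpos by fastforce+
      thus ?thesis using Gamma_plus1[of "1 - \<beta>"] Gamma_plus1[of "2 - \<beta>"] Gamma_plus1[of "3 - \<beta>"] by simp
    qed
    ultimately have "abel_int (Y 4) (3 - \<beta>) t / Gamma (4 - \<beta>) =
        1 / Gamma (1 - \<beta>) * (abel_int (Y 2) (1 - \<beta>) t / (1 - \<beta>))"
      by simp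
    thus ?thesis using False int dI
      unfolding has_RL_derivative_def Y_def I_def by (auto intro: has_integral_integrable)
  qed
qed

section \<open>The Peano kernel of the method\<close>

lemma truncated_cube_has_integral:
  assumes y: "C_m 4 y" "\<And>t. t \<le> 0 \<Longrightarrow> y t = 0" and "x \<le> t" "t \<ge> 0"
  shows "((\<lambda>s. (deriv ^^ 4) y s * (max 0 (x - s)) ^ 3) has_integral 6 * y x) {0..t}"
proof -
  define v where "v = (deriv ^^ 4) y"
  have cv: "continuous_on A v" for A
    using C_m_derivs(2)[OF y, of 4] continuous_on_subset unfolding v_def by blast
  define f where "f = (\<lambda>s. v s * (max 0 (x - s)) ^ 3)"
  have cf: "continuous_on A f" for A
    unfolding f_def by (intro continuous_intros cv)
  have "integral {0..t} f = 6 * y x"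
  proof (cases "x \<ge> 0")
    case True
    \<comment> \<open>The integrand vanishes beyond \<open>x\<close>. Keeping the interval
      \<open>{0..t}\<close> for every \<open>x\<close> lets all shifts of \<open>t\<close> be summed
      under one integral.\<close>
    have "integral {0..t} f = integral {0..x} f + integral {x..t} f"
      using assms True by (intro Henstock_Kurzweil_Integration.integral_combine[symmetric] integrable_continuous_interval cf) auto
    also have "integral {x..t} f = integral {x..t} (\<lambda>_. 0)"
      by (intro integral_cong) (auto simp: f_def max_def)
    also have "integral {0..x} f = abel_int v 3 x"
      unfolding abel_int_def by (intro integral_cong) (auto simp: f_def max_def)
    finally show ?thesis
      using abel_int_representation[OF y True] by (simp add: v_def)
  next
    case False
    hence "integral {0..t} f = integral {0..t} (\<lambda>_. 0)"
      by (intro integral_cong) (auto simp: f_def max_def)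
    thus ?thesis using False y(2)[of x] by simp
  qed
  moreover have "f integrable_on {0..t}"
    by (intro integrable_continuous_interval cf)
  ultimately show ?thesis unfolding f_def v_def by (metis has_integral_integral)
qed

text \<open>Linearity over the shifted cubes; \<open>h ^ 3\<close> comes from scaling the cube and 6
  from Taylor's formula. The series stops at \<open>N\<close> because \<open>y\<close> vanishes at
  \<open>t - k * h \<le> 0\<close>.\<close>

lemma grunwald_method_has_integral:
  fixes a b h t \<beta> :: real
  assumes y: "C_m 4 y" "\<And>t. t \<le> 0 \<Longrightarrow> y t = 0" and "t > 0" "h > 0" and N: "t / h \<le> real N"
  shows "((\<lambda>s. (deriv ^^ 4) y s * (h ^ 3 / 6) * (\<Sum>k\<le>N. grunwald \<beta> k *
            (a * (max 0 ((t - s) / h - real k)) ^ 3 - b * (max 0 ((t - s) / h - real (k + 1))) ^ 3)))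
     has_integral (\<Sum>k. grunwald \<beta> k * (a * y (t - real k * h) - b * y (t - real (k + 1) * h)))) {0..t}"
proof -
  define v where "v = (deriv ^^ 4) y"
  have cube: "h ^ 3 * (max 0 ((t - s) / h - c)) ^ 3 = (max 0 (t - c * h - s)) ^ 3" for s c
  proof -
    have "h * max 0 ((t - s) / h - c) = max 0 (t - c * h - s)"
      using assms(4) by (simp add: max_def field_simps)
    thus ?thesis by (metis power_mult_distrib)
  qed
  have "((\<lambda>s. \<Sum>k\<le>N. grunwald \<beta> k / 6 * (a * (v s * (max 0 (t - real k * h - s)) ^ 3)
          - b * (v s * (max 0 (t - real (k + 1) * h - s)) ^ 3)))
     has_integral (\<Sum>k\<le>N. grunwald \<beta> k / 6 * (a * (6 * y (t - real k * h)) - b * (6 * y (t - real (k + 1) * h))))) {0..t}"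
    unfolding v_def using assms(3,4)
    by (intro has_integral_sum has_integral_mult_right has_integral_diff truncated_cube_has_integral y) auto
  also have "(\<lambda>s. \<Sum>k\<le>N. grunwald \<beta> k / 6 * (a * (v s * (max 0 (t - real k * h - s)) ^ 3)
          - b * (v s * (max 0 (t - real (k + 1) * h - s)) ^ 3))) =
     (\<lambda>s. v s * (h ^ 3 / 6) * (\<Sum>k\<le>N. grunwald \<beta> k *
            (a * (max 0 ((t - s) / h - real k)) ^ 3 - b * (max 0 ((t - s) / h - real (k + 1))) ^ 3)))"
    unfolding cube[symmetric] sum_distrib_left
    by (intro ext sum.cong) (simp_all add: algebra_simps)
  also have "(\<Sum>k\<le>N. grunwald \<beta> k / 6 * (a * (6 * y (t - real k * h)) - b * (6 * y (t - real (k + 1) * h)))) =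
     (\<Sum>k\<le>N. grunwald \<beta> k * (a * y (t - real k * h) - b * y (t - real (k + 1) * h)))"
    by (intro sum.cong) (simp_all add: algebra_simps)
  also have "\<dots> = (\<Sum>k. grunwald \<beta> k * (a * y (t - real k * h) - b * y (t - real (k + 1) * h)))"
  proof (rule suminf_finite[symmetric])
    fix k assume "k \<notin> {..N}"
    hence "t / h \<le> real k" using N by simp
    hence "t \<le> real k * h" using assms(4) by (simp add: field_simps)
    moreover from this have "t \<le> real (k + 1) * h" using assms(4) by (simp add: algebra_simps)
    ultimately show "grunwald \<beta> k * (a * y (t - real k * h) - b * y (t - real (k + 1) * h)) = 0"
      by (simp add: y(2))
  qed simp
  finally show ?thesis by (simp only: v_def)
qed

theorem theorem3:
  fixes \<beta> :: real
  assumes "0 < \<beta>" and "\<beta> \<le> 1"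
  shows "consistent_with_order \<beta>
    (\<lambda>y n. \<Sum>k. grunwald \<beta> k * ((1 + \<beta> / 2) * y (n - int k) - \<beta> / 2 * y (n - int k - 1))) 2"
  unfolding consistent_with_order_explicit
proof (intro exI[of _ "4::nat"] conjI allI impI)
  fix y :: "real \<Rightarrow> real" and t :: real
  assume "C_m 4 y \<and> (\<forall>t\<le>0. y t = 0)" and t: "t > 0"
  hence y: "C_m 4 y" "\<And>t. t \<le> 0 \<Longrightarrow> y t = 0" by auto
  define v where "v = (deriv ^^ 4) y"
  define D where "D = abel_int v (3 - \<beta>) t / Gamma (4 - \<beta>)"
  define A where "A = (\<lambda>h. \<Sum>k. grunwald \<beta> k * ((1 + \<beta> / 2) * y (t - real k * h) - \<beta> / 2 * y (t - real (k + 1) * h)))"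
  define K where "K = (\<lambda>N X. \<Sum>k\<le>N. grunwald \<beta> k * ((1 + \<beta> / 2) * (max 0 (X - real k)) ^ 3
          - \<beta> / 2 * (max 0 (X - real (k + 1))) ^ 3))"
  obtain C where C: "C \<ge> 0" "\<And>X N. 0 \<le> X \<Longrightarrow> X \<le> real N \<Longrightarrow>
      \<bar>K N X - 6 / Gamma (4 - \<beta>) * X powr (3 - \<beta>)\<bar> \<le> C * (1 + X powr (1 - \<beta>))"
    using combined_kernel_asymp[OF assms] unfolding K_def by blast
  have cv: "continuous_on {0..t} v"
    using C_m_derivs(2)[OF y, of 4] continuous_on_subset unfolding v_def by blast
  have "bounded (v ` {0..t})"
    by (intro compact_imp_bounded compact_continuous_image cv compact_Icc)
  then obtain V where V: "V > 0" "\<And>s. s \<in> {0..t} \<Longrightarrow> \<bar>v s\<bar> \<le> V"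
    unfolding bounded_pos by auto
  have error: "\<bar>1 / h powr \<beta> * A h - D\<bar> \<le> V * (C * (2 + t) * h\<^sup>2) * t" if h: "0 < h" "h < 1" for h
  proof -
    define N where "N = nat \<lceil>t / h\<rceil>"
    have N: "t / h \<le> real N" unfolding N_def by linarith
    have h3: "1 / h powr \<beta> * h ^ 3 = h powr (3 - \<beta>)"
      using h by (simp add: powr_diff powr_numeral)
    have h2: "h powr (3 - \<beta>) = h\<^sup>2 * h powr (1 - \<beta>)"
      using h powr_add[of h 2 "1 - \<beta>"] by (simp add: powr_numeral)
    \<comment> \<open>Method and derivative are both integrals against \<open>v\<close>, so their
      difference is the integral of \<open>v\<close> times the kernel error, which is estimated
      pointwise.\<close>
    have "((\<lambda>s. 1 / h powr \<beta> * (v s * (h ^ 3 / 6) * K N ((t - s) / h)) - v s * (t - s) powr (3 - \<beta>) / Gamma (4 - \<beta>))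
        has_integral (1 / h powr \<beta> * A h - D)) {0..t}"
      unfolding D_def abel_int_def
    proof (intro has_integral_diff has_integral_mult_right has_integral_divide integrable_integral)
      show "((\<lambda>s. v s * (h ^ 3 / 6) * K N ((t - s) / h)) has_integral A h) {0..t}"
        unfolding v_def K_def A_def using y t h(1) N by (intro grunwald_method_has_integral)
      show "(\<lambda>s. v s * (t - s) powr (3 - \<beta>)) integrable_on {0..t}"
        using assms by (intro integrable_continuous_interval continuous_intros cv continuous_on_powr') auto
    qed
    moreover have "norm (1 / h powr \<beta> * (v s * (h ^ 3 / 6) * K N ((t - s) / h)) - v s * (t - s) powr (3 - \<beta>) / Gamma (4 - \<beta>))
        \<le> V * (C * (2 + t) * h\<^sup>2)" if s: "s \<in> {0..t}" for s
    proof -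
      define X where "X = (t - s) / h"
      have X: "0 \<le> X" "X \<le> real N"
        using s h(1) divide_right_mono[of "t - s" t h] N by (auto simp: X_def)
      have ts: "t - s = h * X" using h by (simp add: X_def)
      have "1 / h powr \<beta> * (v s * (h ^ 3 / 6) * K N X) = v s / 6 * ((1 / h powr \<beta> * h ^ 3) * K N X)"
        by simp
      moreover have "v s * (t - s) powr (3 - \<beta>) / Gamma (4 - \<beta>) =
           v s / 6 * (h powr (3 - \<beta>) * (6 / Gamma (4 - \<beta>) * X powr (3 - \<beta>)))"
        unfolding ts using h X by (simp add: powr_mult)
      ultimately have "1 / h powr \<beta> * (v s * (h ^ 3 / 6) * K N X) - v s * (t - s) powr (3 - \<beta>) / Gamma (4 - \<beta>) =
           v s / 6 * (h powr (3 - \<beta>) * (K N X - 6 / Gamma (4 - \<beta>) * X powr (3 - \<beta>)))"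
        unfolding h3 by (simp add: right_diff_distrib)
      also have "\<bar>\<dots>\<bar> = \<bar>v s / 6\<bar> * (h powr (3 - \<beta>) * \<bar>K N X - 6 / Gamma (4 - \<beta>) * X powr (3 - \<beta>)\<bar>)"
        by (simp add: abs_mult)
      also have "\<dots> \<le> V * (h powr (3 - \<beta>) * (C * (1 + X powr (1 - \<beta>))))"
        using V(1) V(2)[OF s] C(2)[OF X] by (intro mult_mono) auto
      \<comment> \<open>The order 2 emerges here: by \<open>h * X = t - s\<close>, a factor
        \<open>h ^ 2\<close> splits off and the remaining powers stay bounded in \<open>h\<close>
        and \<open>s\<close>.\<close>
      also have "h powr (3 - \<beta>) * (C * (1 + X powr (1 - \<beta>))) = C * h\<^sup>2 * (h powr (1 - \<beta>) + (t - s) powr (1 - \<beta>))"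
        unfolding ts h2 using h X by (simp add: powr_mult algebra_simps)
      also have "\<dots> \<le> C * h\<^sup>2 * (1 + (1 + t))"
      proof (intro mult_left_mono add_mono)
        show "h powr (1 - \<beta>) \<le> 1" using h assms powr_mono2[of "1 - \<beta>" h 1] by simp
        have "(t - s) powr (1 - \<beta>) \<le> (1 + t) powr (1 - \<beta>)" using s assms by (intro powr_mono2) auto
        also have "\<dots> \<le> (1 + t) powr 1" using t assms by (intro powr_mono) auto
        finally show "(t - s) powr (1 - \<beta>) \<le> 1 + t" using t by simp
      qed (use C in auto)
      finally show ?thesis using V(1) by (simp add: X_def mult_ac)
    qed
    moreover have "0 \<le> V * (C * (2 + t) * h\<^sup>2)" using V C t by simp
    ultimately have "norm (1 / h powr \<beta> * A h - D) \<le> V * (C * (2 + t) * h\<^sup>2) * measure lborel {0..t}"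
      by (intro has_integral_bound_real) auto
    thus ?thesis using t by simp
  qed
  have "(\<lambda>h. 1 / h powr \<beta> * A h - D) \<in> O[at_right 0](\<lambda>h. h ^ 2)"
  proof (rule bigoI)
    show "eventually (\<lambda>h. norm (1 / h powr \<beta> * A h - D) \<le> (V * C * (2 + t) * t) * norm (h ^ 2)) (at_right 0)"
      using eventually_at_right_real[of 0 "1::real", OF zero_less_one]
    proof eventually_elim
      case (elim h)
      thus ?case using error[of h] by (simp add: mult_ac)
    qed
  qed
  moreover have "has_RL_derivative \<beta> y D t"
    unfolding D_def v_def using y assms t by (rule has_RL_derivative_abel_int)
  ultimately show "\<exists>D. has_RL_derivative \<beta> y D t \<and> (\<lambda>h. 1 / h powr \<beta> *
      (\<Sum>k. grunwald \<beta> k * ((1 + \<beta> / 2) * y (t - real k * h) - \<beta> / 2 * y (t - real (k + 1) * h))) - D)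
        \<in> O[at_right 0](\<lambda>h. h ^ 2)"
    unfolding A_def by blast
qed simp

end
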